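(* Fix delays $0<\tau_1<\dots<\tau_K$, matrices $A_0,B_k,C_k,D_{kl},B_v,D_{kv},C_{ri},B_{rki},D_{rvi},C_{vi}$ ($k,l\in\{1,2\}$, $i=1,\dots,K$) and bounded measurable matrix-valued functions $C_{vdi}$ on $[-\tau_i,0]$, defining an ODE-PDE. Put $\hat C_{vi}=C_{vi} +\int_{-1}^0 \tau_iC_{vdi}(\tau_i s)ds$ and assume $I_{n_v}-\sum_{i=1}^K \hat C_{vi}D_{rvi}$ is invertible. Let $\mathcal{T},\mathcal{A},\mathcal{B}_k,\mathcal{B}_{T_k},\mathcal{C}_k,\mathcal{D}_{kl}$ be the associated PIE operators defined in the context. Let $u\in L_2[0,\infty)^p$ and $w\in L_2[0,\infty)^m$; if some $B_{r1i}\neq0$ assume also $w\in W^{1,2}[0,\infty)^m$ with $w(0)=0$, and if some $B_{r2i}\neq 0$ assume also $u\in W^{1,2}[0,\infty)^p$ with $u(0)=0$. (1) Let $x_0\in\mathbb{R}^n$ and $\phi_{i0}\in W^{1,2}[-1,0]^{p_i}$ satisfy the sewing condition $$\phi_{i0}(0)=C_{ri}x_0+D_{rvi}\Big(\sum_{j=1}^K C_{vj} \phi_{j0}(-1)+\sum_{j=1}^K \int_{-1}^0\tau_jC_{vdj}(\tau_j s) \phi_{j0}(s)ds\Big),\quad i=1,\dots,K,$$ and suppose $x,\phi_i,v,y,z$ satisfy the ODE-PDE for $u,w$ and these initial conditions. Then $y$, $z$ and $$\mathbf{x}(t):=\begin{bmatrix}x(t) \\ \partial_s \phi_{1}(t,\cdot)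 \\ \vdots \\ \partial_s \phi_{K}(t,\cdot)\end{bmatrix}$$ satisfy the PIE defined by $\{\mathcal{T},\mathcal{A},\mathcal{B}_k,\mathcal{C}_k,\mathcal{D}_{kl},\mathcal{B}_{T_k}\}$ for $u,w$ with initial condition $$\mathbf{x}_0:=\begin{bmatrix}x_0 \\ \partial_s \phi_{10} \\ \vdots \\ \partial_s \phi_{K0}\end{bmatrix}.$$ (2) Conversely, let $\mathbf{x}_0\in\mathbb{R}^n\times L_2[-1,0]^{\sum_ip_i}$ and suppose $y,z,\mathbf{x}$ satisfy the PIE defined by $\{\mathcal{T},\mathcal{A},\mathcal{B}_k,\mathcal{C}_k,\mathcal{D}_{kl},\mathcal{B}_{T_k}\}$ for $u,w$ with initial condition $\mathbf{x}_0$. Then $x,\phi_i,v,y,z$ satisfy the ODE-PDE for $u,w$ with initial conditions $x_0,\phi_{i0}$ (in particular these satisfy the sewing condition), where $$\begin{bmatrix}x(t) \\ \phi_{1}(t,\cdot) \\ \vdots \\ \phi_{K}(t,\cdot)\end{bmatrix}=\mathcal{T}\mathbf{x}(t)+\mathcal{B}_{T_1}w(t)+\mathcal{B}_{T_2}u(t),\qquad \begin{bmatrix}x_0 \\ \phi_{10} \\ \vdots \\ \phi_{K0}\end{bmatrix}=\mathcal{T}\mathbf{x}_0,$$ and $v(t)=\sum_{i=1}^K C_{vi} \phi_i(t,-1)+\sum_{i=1}^K \int_{-1}^0\tau_iC_{vdi}(\tau_i s) \phi_i(t, s)ds$.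
   Context: All functions in $W^{1,2}$ are identified with their absolutely continuous representatives; $u,w$ are functions defined at every $t\ge0$. Derivatives at $t=0$ are from the right. Dimensions: $x(t)\in\mathbb{R}^n$, $w(t)\in\mathbb{R}^m$, $u(t)\in\mathbb{R}^p$, $z(t)\in\mathbb{R}^q$, $y(t)\in\mathbb{R}^r$, $v(t)\in\mathbb{R}^{n_v}$, $\phi_i(t,s)\in\mathbb{R}^{p_i}$; matrix dimensions are the compatible ones. Write $P=\sum_{i=1}^Kp_i$. **ODE-PDE.** For given $u,w$ and initial conditions $x_0\in\mathbb{R}^n$, $\phi_{i0}\in W^{1,2}[-1,0]^{p_i}$ satisfying the sewing condition displayed in the claim, functions $x,z,y,v$ on $[0,\infty)$ and $\phi_i(t)=\phi_i(t,\cdot)\in W^{1,2}[-1,0]^{p_i}$, $t\ge0$, satisfy the ODE-PDE if $x$ is differentiable on $[0,\infty)$, each $t\mapsto\phi_i(t)$ is Fréchet differentiable on $[0,\infty)$ as a map into $W^{1,2}[-1,0]^{p_i}$, $x(0)=x_0$, $\phi_i(0,s)=\phi_{i0}(s)$ for $s\in[-1,0]$, and for all $t\ge0$, $i=1,\dots,K$, $$\begin{bmatrix}\dot x(t) \\ z(t) \\ y(t) \\ \phi_i(t,0)\end{bmatrix}=\begin{bmatrix}A_0 & B_1& B_2 \\ C_1 &D_{11}&D_{12} \\ C_2&D_{21}&D_{22} \\ C_{ri}&B_{r1i}&B_{r2i}\end{bmatrix}\begin{bmatrix}x(t) \\ w(t) \\ u(t)\end{bmatrix}+\begin{bmatrix}B_v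 \\ D_{1v} \\ D_{2v} \\ D_{rvi}\end{bmatrix} v(t),$$ $$\dot \phi_i(t,s)=\frac{1}{\tau_i}\partial_s\phi_i(t,s)\ \text{ (equality in } L_2[-1,0]^{p_i}),\qquad v(t)=\sum_{i=1}^K C_{vi} \phi_i(t,-1)+\sum_{i=1}^K \int_{-1}^0\tau_iC_{vdi}(\tau_i s) \phi_i(t, s)ds.$$ **PIE.** For given $u,w$ and $\mathbf{x}_0\in\mathbb{R}^n\times L_2[-1,0]^{P}$, functions $\mathbf{x}(t)\in\mathbb{R}^n\times L_2[-1,0]^P$, $z(t)\in\mathbb{R}^q$, $y(t)\in\mathbb{R}^r$ ($t\ge0$) satisfy the PIE if $\mathbf{x}$ is Fréchet differentiable on $[0,\infty)$ as a map into $\mathbb{R}^n\times L_2[-1,0]^P$, $\mathbf{x}(0)=\mathbf{x}_0$, and for all $t\ge0$ $$\mathcal{T}\dot{\mathbf{x}}(t)+\mathcal{B}_{T_1}\dot w(t)+\mathcal{B}_{T_2}\dot u(t)=\mathcal{A}\mathbf{x}(t)+\mathcal{B}_1w(t)+\mathcal{B}_2u(t),$$ $$z(t)=\mathcal{C}_1\mathbf{x}(t)+\mathcal{D}_{11}w(t)+\mathcal{D}_{12}u(t),\qquad y(t)=\mathcal{C}_2\mathbf{x}(t)+\mathcal{D}_{21}w(t)+\mathcal{D}_{22}u(t).$$ Here $\mathcal{B}_{T_1}\dot w(t)+\mathcal{B}_{T_2}\dot u(t)$ denotes the time derivative at $t$ of $\mathcal{B}_{T_1}w+\mathcal{B}_{T_2}u$,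 whose existence at every $t\ge 0$ is part of satisfying the PIE. **Matrices.** With $\hat C_{vi}$ as in the claim, let $$D_I=\Big(I_{n_v}-\sum_{i=1}^K \hat C_{vi}D_{rvi}\Big)^{-1},\quad C_{Ii}(s)=-D_I\Big(C_{vi} +\tau_i\int_{-1}^sC_{vdi}(\tau_i \eta) d \eta \Big),\quad \begin{bmatrix}C_{vx}&D_{vw}&D_{vu}\end{bmatrix}=D_I\sum_{i=1}^K \hat C_{vi} \begin{bmatrix}C_{ri}&B_{r1i}&B_{r2i}\end{bmatrix},$$ $$\begin{bmatrix}\mathbf T_0 & \mathbf T_1 &\mathbf T_2\end{bmatrix}=\begin{bmatrix}C_{r1} & B_{r11} & B_{r21} \\ \vdots&\vdots&\vdots \\ C_{rK} & B_{r1K}& B_{r2K}\end{bmatrix} +\begin{bmatrix}D_{rv1} \\ \vdots \\ D_{rvK} \end{bmatrix}\begin{bmatrix}C_{vx}&D_{vw}&D_{vu}\end{bmatrix},$$ $$\mathbf T_{a}(s,\theta)=\begin{bmatrix}D_{rv1} \\ \vdots \\ D_{rvK}\end{bmatrix}\begin{bmatrix}C_{I1}(\theta)&\cdots&C_{IK}(\theta)\end{bmatrix},\quad \mathbf T_{b}(s,\theta)=-I_{P}+\mathbf T_{a}(s,\theta),\quad I_\tau=\mathrm{diag}\Big(\tfrac{1}{\tau_1}I_{p_1},\dots,\tfrac{1}{\tau_K}I_{p_K}\Big),$$ $$\begin{bmatrix}\mathbf A(s) \\ \mathbf C_{11}(s) \\ \mathbf C_{21}(s) \end{bmatrix}=\begin{bmatrix}B_v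 \\ D_{1v} \\ D_{2v} \end{bmatrix}\begin{bmatrix}C_{I1}(s)&\cdots&C_{IK}(s)\end{bmatrix},\quad \begin{bmatrix} \mathbf A_0&\mathbf B_1&\mathbf B_2 \\ \mathbf C_{10}&\mathbf D_{11}&\mathbf D_{12} \\ \mathbf C_{20}&\mathbf D_{21}&\mathbf D_{22}\end{bmatrix}=\begin{bmatrix} A_0& B_1&B_2 \\ C_{1}& D_{11}& D_{12} \\ C_{2}&D_{21}& D_{22}\end{bmatrix}+\begin{bmatrix}B_v \\ D_{1v} \\ D_{2v} \end{bmatrix}\begin{bmatrix}C_{vx}&D_{vw}&D_{vu}\end{bmatrix}.$$ **Operators.** For $x\in\mathbb{R}^n$, $\Phi\in L_2[-1,0]^P$, $\omega\in\mathbb{R}^m$, $\mu\in\mathbb{R}^p$: $$\mathcal{A}\begin{bmatrix}x \\ \Phi\end{bmatrix}(s)=\begin{bmatrix}\mathbf A_0x+\int_{-1}^0\mathbf A(\theta)\Phi(\theta)d\theta \\ I_\tau\Phi(s)\end{bmatrix},\qquad \mathcal{T}\begin{bmatrix}x \\ \Phi\end{bmatrix}(s)=\begin{bmatrix}x \\ \mathbf T_0x+\int_{-1}^s\mathbf T_a(s,\theta)\Phi(\theta)d\theta+\int_s^0\mathbf T_b(s,\theta)\Phi(\theta)d\theta\end{bmatrix},$$ $$\mathcal{B}_1\omega=\begin{bmatrix}\mathbf B_1\omega \\ 0\end{bmatrix},\quad \mathcal{B}_2\mu=\begin{bmatrix}\mathbf B_2\mu \\ 0\end{bmatrix},\quad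 \mathcal{B}_{T_1}\omega=\begin{bmatrix}0 \\ \mathbf T_1\omega\end{bmatrix},\quad \mathcal{B}_{T_2}\mu=\begin{bmatrix}0 \\ \mathbf T_2\mu\end{bmatrix}$$ (the second components being constant functions of $s$), $\mathcal{C}_k\begin{bmatrix}x \\ \Phi\end{bmatrix}=\mathbf C_{k0}x+\int_{-1}^0\mathbf C_{k1}(\theta)\Phi(\theta)d\theta$ for $k=1,2$, and $\mathcal{D}_{kl}$ is multiplication by $\mathbf D_{kl}$. *)

theory Defs
  imports "HOL-Analysis.Analysis" "HOL-Library.Function_Algebras"
begin

section \<open>Function spaces\<close>

text \<open>
  Elements of \<open>L\<^sub>2\<close> are handled through representatives: \<open>L2 I\<close> is a set of functions, \<open>L2_norm\<close> a
  seminorm on it, and equality in \<open>L\<^sub>2\<close> is always written as equality almost everywhere. Values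
  outside \<open>I\<close> are irrelevant. Vector operations on functions are pointwise; Function_Algebras
  supplies the additive group and the instance below the scalar multiplication.
\<close>

instantiation "fun" :: (type, real_vector) real_vector
begin

definition scaleR_fun :: "real \<Rightarrow> ('a \<Rightarrow> 'b) \<Rightarrow> 'a \<Rightarrow> 'b"
  where "scaleR_fun r f = (\<lambda>s. r *\<^sub>R f s)"

instance
  by standard (simp_all add: scaleR_fun_def fun_eq_iff scaleR_add_right scaleR_add_left)

end

definition L2 :: "real set \<Rightarrow> (real \<Rightarrow> 'a::euclidean_space) set" where
  "L2 I = {f. f \<in> borel_measurable (lebesgue_on I) \<and> integrable (lebesgue_on I) (\<lambda>s. (norm (f s))\<^sup>2)}"

definition L2_norm :: "real set \<Rightarrow> (real \<Rightarrow> 'a::euclidean_space) \<Rightarrow> real" where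
  "L2_norm I f = sqrt (LINT s|lebesgue_on I. (norm (f s))\<^sup>2)"

text \<open>
  \<open>has_wderiv I f g\<close>: on the interval \<open>I\<close> the function \<open>f\<close> is (locally) absolutely continuous with
  derivative \<open>g \<in> L\<^sub>2\<close>. So members of \<open>W12 I\<close> are the absolutely continuous representatives themselves
  and may be evaluated at points of \<open>I\<close>. The derivative \<open>wderiv\<close> is determined up to a null set.
\<close>

definition has_wderiv ::
    "real set \<Rightarrow> (real \<Rightarrow> 'a::euclidean_space) \<Rightarrow> (real \<Rightarrow> 'a) \<Rightarrow> bool" where
  "has_wderiv I f g \<longleftrightarrow> g \<in> L2 I \<and>
     (\<forall>s\<in>I. \<forall>t\<in>I. s \<le> t \<longrightarrow> f t = f s + (LINT \<theta>|lebesgue_on {s..t}. g \<theta>))"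

definition W12 :: "real set \<Rightarrow> (real \<Rightarrow> 'a::euclidean_space) set" where
  "W12 I = {f \<in> L2 I. \<exists>g. has_wderiv I f g}"

definition wderiv :: "real set \<Rightarrow> (real \<Rightarrow> 'a::euclidean_space) \<Rightarrow> real \<Rightarrow> 'a" where
  "wderiv I f = (SOME g. has_wderiv I f g)"

definition W12_norm :: "real set \<Rightarrow> (real \<Rightarrow> 'a::euclidean_space) \<Rightarrow> real" where
  "W12_norm I f = sqrt ((L2_norm I f)\<^sup>2 + (L2_norm I (wderiv I f))\<^sup>2)"

text \<open>The space \<open>\<real>\<^sup>n \<times> L\<^sub>2[-1,0]\<^sup>P\<close>.\<close>

definition Z_space :: "('a::euclidean_space \<times> (real \<Rightarrow> 'b::euclidean_space)) set" where
  "Z_space = UNIV \<times> L2 {-1..0}"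

definition Z_norm :: "'a::euclidean_space \<times> (real \<Rightarrow> 'b::euclidean_space) \<Rightarrow> real" where
  "Z_norm X = sqrt ((norm (fst X))\<^sup>2 + (L2_norm {-1..0} (snd X))\<^sup>2)"

definition Z_eq ::
    "'a::euclidean_space \<times> (real \<Rightarrow> 'b::euclidean_space) \<Rightarrow> 'a \<times> (real \<Rightarrow> 'b) \<Rightarrow> bool" where
  "Z_eq X Y \<longleftrightarrow> fst X = fst Y \<and> (AE s in lebesgue_on {-1..0}. snd X s = snd Y s)"

text \<open>
  \<open>D\<close> is the Frechet derivative at \<open>t\<close> of the map \<open>F\<close> from \<open>[0,\<infinity>)\<close> into the space \<open>V\<close> with (semi)norm
  \<open>N\<close>; at \<open>t = 0\<close> it is the derivative from the right. The library's \<open>has_vector_derivative\<close> is not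
  available, since \<open>V\<close> is not a normed type.
\<close>

definition frechet_deriv ::
    "'f::real_vector set \<Rightarrow> ('f \<Rightarrow> real) \<Rightarrow> (real \<Rightarrow> 'f) \<Rightarrow> 'f \<Rightarrow> real \<Rightarrow> bool" where
  "frechet_deriv V N F D t \<longleftrightarrow> (\<forall>r\<ge>0. F r \<in> V) \<and> D \<in> V \<and>
     ((\<lambda>r. N ((F r - F t) /\<^sub>R (r - t) - D)) \<longlongrightarrow> 0) (at t within {0..})"


section \<open>The ODE-PDE\<close>

text \<open>
  The delays are indexed by a finite linear order \<open>'k\<close> with \<open>K\<close> elements. As the dimensions \<open>p\<^sub>i\<close> depend
  on \<open>i\<close>, the product of the \<open>\<real>\<^bsup>p_i\<^esup>\<close> is the type \<open>real^'c\<close>, where \<open>'c\<close> has \<open>P\<close> elements and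
  \<open>blk :: 'c \<Rightarrow> 'k\<close> tells to which block a coordinate belongs: \<open>p\<^sub>i\<close> is the number of \<open>c\<close> with
  \<open>blk c = i\<close>, and \<open>\<phi>\<^sub>i(t,s)\<close> consists of the coordinates \<open>c\<close> of \<open>\<phi> t s :: real^'c\<close> with \<open>blk c = i\<close>.
  Every choice of \<open>K\<close> and of the \<open>p\<^sub>i\<close> arises in this way.

  Accordingly \<open>Cr\<close>, \<open>Br1\<close>, \<open>Br2\<close>, \<open>Drv\<close> are the column stacks of \<open>C\<^bsub>ri\<^esub>\<close>, \<open>B\<^bsub>r1i\<^esub>\<close>, \<open>B\<^bsub>r2i\<^esub>\<close>, \<open>D\<^bsub>rvi\<^esub>\<close> (block
  \<open>i\<close> of rows belonging to \<open>i\<close>), and \<open>Cv = [C\<^bsub>v1\<^esub> \<dots> C\<^bsub>vK\<^esub>]\<close>. In \<open>Cvd\<close> the columns in block \<open>i\<close> form the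
  function \<open>C\<^bsub>vdi\<^esub>\<close>, which is only meaningful on \<open>[-\<tau>\<^sub>i,0]\<close>.
\<close>

record ('n, 'm, 'p, 'q, 'r, 'v, 'c, 'k) sys =
  tau :: "'k \<Rightarrow> real"
  blk :: "'c \<Rightarrow> 'k"
  A0  :: "real^'n^'n"   B1  :: "real^'m^'n"   B2  :: "real^'p^'n"   Bv  :: "real^'v^'n"
  C1  :: "real^'n^'q"   D11 :: "real^'m^'q"   D12 :: "real^'p^'q"   D1v :: "real^'v^'q"
  C2  :: "real^'n^'r"   D21 :: "real^'m^'r"   D22 :: "real^'p^'r"   D2v :: "real^'v^'r"
  Cr  :: "real^'n^'c"   Br1 :: "real^'m^'c"   Br2 :: "real^'p^'c"   Drv :: "real^'v^'c"
  Cv  :: "real^'c^'v"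
  Cvd :: "real \<Rightarrow> real^'c^'v"

text \<open>
  \<open>cblock S i M\<close> is the block \<open>M\<^sub>i\<close> of \<open>M = [M\<^sub>1 \<dots> M\<^sub>K]\<close>, kept in its place (with zero columns elsewhere).
  Thus \<open>cblock S i M *v f\<close> is \<open>M\<^sub>i f\<^sub>i\<close>, \<open>cblock S i M ** N\<close> is \<open>M\<^sub>i N\<^sub>i\<close> for a column stack \<open>N\<close> of
  matrices \<open>N\<^sub>i\<close>, and the concatenation of blocks is their sum.
\<close>

definition cblock ::
    "('n::finite, 'm::finite, 'p::finite, 'q::finite,
      'r::finite, 'v::finite, 'c::finite, 'k::finite) sys \<Rightarrow>
     'k \<Rightarrow> real^'c^'v \<Rightarrow> real^'c^'v" where
  "cblock S i M = (\<chi> j c. if blk S c = i then M $ j $ c else 0)"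

definition delay_out ::
    "('n::finite, 'm::finite, 'p::finite, 'q::finite,
      'r::finite, 'v::finite, 'c::finite, 'k::finite) sys \<Rightarrow>
     (real \<Rightarrow> real^'c) \<Rightarrow> real^'v" where
  "delay_out S f = (\<Sum>i\<in>UNIV. cblock S i (Cv S) *v f (-1)) +
     (\<Sum>i\<in>UNIV. LINT s|lebesgue_on {-1..0}. (tau S i *\<^sub>R cblock S i (Cvd S (tau S i * s))) *v f s)"

definition sewing ::
    "('n::finite, 'm::finite, 'p::finite, 'q::finite,
      'r::finite, 'v::finite, 'c::finite, 'k::finite) sys \<Rightarrow>
     real^'n \<Rightarrow> (real \<Rightarrow> real^'c) \<Rightarrow> bool" where
  "sewing S x0 \<phi>0 \<longleftrightarrow> \<phi>0 0 = Cr S *v x0 + Drv S *v delay_out S \<phi>0"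

definition satisfies_ODE_PDE ::
    "('n::finite, 'm::finite, 'p::finite, 'q::finite,
      'r::finite, 'v::finite, 'c::finite, 'k::finite) sys \<Rightarrow>
     (real \<Rightarrow> real^'p) \<Rightarrow> (real \<Rightarrow> real^'m) \<Rightarrow>
     real^'n \<Rightarrow> (real \<Rightarrow> real^'c) \<Rightarrow>
     (real \<Rightarrow> real^'n) \<Rightarrow> (real \<Rightarrow> real \<Rightarrow> real^'c) \<Rightarrow> (real \<Rightarrow> real^'v) \<Rightarrow>
     (real \<Rightarrow> real^'r) \<Rightarrow> (real \<Rightarrow> real^'q) \<Rightarrow> bool" where
  "satisfies_ODE_PDE S u w x0 \<phi>0 x \<phi> v y z \<longleftrightarrow>
     \<phi>0 \<in> W12 {-1..0} \<and> sewing S x0 \<phi>0 \<and>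
     x 0 = x0 \<and> (\<forall>s\<in>{-1..0}. \<phi> 0 s = \<phi>0 s) \<and>
     (\<forall>t\<ge>0. (x has_vector_derivative
        (A0 S *v x t + B1 S *v w t + B2 S *v u t + Bv S *v v t)) (at t within {0..})) \<and>
     (\<forall>t\<ge>0. z t = C1 S *v x t + D11 S *v w t + D12 S *v u t + D1v S *v v t) \<and>
     (\<forall>t\<ge>0. y t = C2 S *v x t + D21 S *v w t + D22 S *v u t + D2v S *v v t) \<and>
     (\<forall>t\<ge>0. \<phi> t 0 = Cr S *v x t + Br1 S *v w t + Br2 S *v u t + Drv S *v v t) \<and>
     (\<forall>t\<ge>0. \<exists>d. frechet_deriv (W12 {-1..0}) (W12_norm {-1..0}) \<phi> d t \<and>
        (AE s in lebesgue_on {-1..0}. \<forall>i c. blk S c = i \<longrightarrow>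
           d s $ c = (1 / tau S i) * wderiv {-1..0} (\<phi> t) s $ c)) \<and>
     (\<forall>t\<ge>0. v t = delay_out S (\<phi> t))"


section \<open>The PIE\<close>

text \<open>
  A prefix \<open>b\<close> marks the boldface matrices. The matrices of the form \<open>D\<^sub>I \<Sum>\<^sub>i \<dots>\<close> only make
  sense if \<open>mat 1 - (\<Sum>i\<in>UNIV. Chat S i ** Drv S)\<close> is invertible.
\<close>

definition Chat ::
    "('n::finite, 'm::finite, 'p::finite, 'q::finite,
      'r::finite, 'v::finite, 'c::finite, 'k::finite) sys \<Rightarrow>
     'k \<Rightarrow> real^'c^'v" where
  "Chat S i = cblock S i (Cv S) +
     (LINT s|lebesgue_on {-1..0}. tau S i *\<^sub>R cblock S i (Cvd S (tau S i * s)))"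

definition DI ::
    "('n::finite, 'm::finite, 'p::finite, 'q::finite,
      'r::finite, 'v::finite, 'c::finite, 'k::finite) sys \<Rightarrow>
     real^'v^'v" where
  "DI S = matrix_inv (mat 1 - (\<Sum>i\<in>UNIV. Chat S i ** Drv S))"

text \<open>\<open>CIi S i\<close> is \<open>C\<^bsub>Ii\<^esub>\<close> kept in its place, so that \<open>CI S s\<close> is \<open>[C\<^bsub>I1\<^esub>(s) \<dots> C\<^bsub>IK\<^esub>(s)]\<close>.\<close>

definition CIi ::
    "('n::finite, 'm::finite, 'p::finite, 'q::finite,
      'r::finite, 'v::finite, 'c::finite, 'k::finite) sys \<Rightarrow>
     'k \<Rightarrow> real \<Rightarrow> real^'c^'v" where
  "CIi S i s = - (DI S ** (cblock S i (Cv S) +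
     tau S i *\<^sub>R (LINT \<eta>|lebesgue_on {-1..s}. cblock S i (Cvd S (tau S i * \<eta>)))))"

definition CI ::
    "('n::finite, 'm::finite, 'p::finite, 'q::finite,
      'r::finite, 'v::finite, 'c::finite, 'k::finite) sys \<Rightarrow>
     real \<Rightarrow> real^'c^'v" where
  "CI S s = (\<Sum>i\<in>UNIV. CIi S i s)"

definition Cvx ::
    "('n::finite, 'm::finite, 'p::finite, 'q::finite,
      'r::finite, 'v::finite, 'c::finite, 'k::finite) sys \<Rightarrow>
     real^'n^'v" where
  "Cvx S = DI S ** (\<Sum>i\<in>UNIV. Chat S i ** Cr S)"

definition Dvw ::
    "('n::finite, 'm::finite, 'p::finite, 'q::finite,
      'r::finite, 'v::finite, 'c::finite, 'k::finite) sys \<Rightarrow>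
     real^'m^'v" where
  "Dvw S = DI S ** (\<Sum>i\<in>UNIV. Chat S i ** Br1 S)"

definition Dvu ::
    "('n::finite, 'm::finite, 'p::finite, 'q::finite,
      'r::finite, 'v::finite, 'c::finite, 'k::finite) sys \<Rightarrow>
     real^'p^'v" where
  "Dvu S = DI S ** (\<Sum>i\<in>UNIV. Chat S i ** Br2 S)"

definition bT0 ::
    "('n::finite, 'm::finite, 'p::finite, 'q::finite,
      'r::finite, 'v::finite, 'c::finite, 'k::finite) sys \<Rightarrow>
     real^'n^'c" where
  "bT0 S = Cr S + Drv S ** Cvx S"

definition bT1 ::
    "('n::finite, 'm::finite, 'p::finite, 'q::finite,
      'r::finite, 'v::finite, 'c::finite, 'k::finite) sys \<Rightarrow>
     real^'m^'c" where
  "bT1 S = Br1 S + Drv S ** Dvw S"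

definition bT2 ::
    "('n::finite, 'm::finite, 'p::finite, 'q::finite,
      'r::finite, 'v::finite, 'c::finite, 'k::finite) sys \<Rightarrow>
     real^'p^'c" where
  "bT2 S = Br2 S + Drv S ** Dvu S"

definition bTa ::
    "('n::finite, 'm::finite, 'p::finite, 'q::finite,
      'r::finite, 'v::finite, 'c::finite, 'k::finite) sys \<Rightarrow>
     real \<Rightarrow> real \<Rightarrow> real^'c^'c" where
  "bTa S s \<theta> = Drv S ** CI S \<theta>"

definition bTb ::
    "('n::finite, 'm::finite, 'p::finite, 'q::finite,
      'r::finite, 'v::finite, 'c::finite, 'k::finite) sys \<Rightarrow>
     real \<Rightarrow> real \<Rightarrow> real^'c^'c" where
  "bTb S s \<theta> = - mat 1 + bTa S s \<theta>"

definition Itau ::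
    "('n::finite, 'm::finite, 'p::finite, 'q::finite,
      'r::finite, 'v::finite, 'c::finite, 'k::finite) sys \<Rightarrow>
     real^'c^'c" where
  "Itau S = (\<chi> c d. if c = d then 1 / tau S (blk S c) else 0)"

definition bA ::
    "('n::finite, 'm::finite, 'p::finite, 'q::finite,
      'r::finite, 'v::finite, 'c::finite, 'k::finite) sys \<Rightarrow>
     real \<Rightarrow> real^'c^'n" where
  "bA S s = Bv S ** CI S s"

definition bC11 ::
    "('n::finite, 'm::finite, 'p::finite, 'q::finite,
      'r::finite, 'v::finite, 'c::finite, 'k::finite) sys \<Rightarrow>
     real \<Rightarrow> real^'c^'q" where
  "bC11 S s = D1v S ** CI S s"

definition bC21 ::
    "('n::finite, 'm::finite, 'p::finite, 'q::finite,
      'r::finite, 'v::finite, 'c::finite, 'k::finite) sys \<Rightarrow>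
     real \<Rightarrow> real^'c^'r" where
  "bC21 S s = D2v S ** CI S s"

definition bA0 ::
    "('n::finite, 'm::finite, 'p::finite, 'q::finite,
      'r::finite, 'v::finite, 'c::finite, 'k::finite) sys \<Rightarrow>
     real^'n^'n" where
  "bA0 S = A0 S + Bv S ** Cvx S"

definition bB1 ::
    "('n::finite, 'm::finite, 'p::finite, 'q::finite,
      'r::finite, 'v::finite, 'c::finite, 'k::finite) sys \<Rightarrow>
     real^'m^'n" where
  "bB1 S = B1 S + Bv S ** Dvw S"

definition bB2 ::
    "('n::finite, 'm::finite, 'p::finite, 'q::finite,
      'r::finite, 'v::finite, 'c::finite, 'k::finite) sys \<Rightarrow>
     real^'p^'n" where
  "bB2 S = B2 S + Bv S ** Dvu S"

definition bC10 ::
    "('n::finite, 'm::finite, 'p::finite, 'q::finite,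
      'r::finite, 'v::finite, 'c::finite, 'k::finite) sys \<Rightarrow>
     real^'n^'q" where
  "bC10 S = C1 S + D1v S ** Cvx S"

definition bD11 ::
    "('n::finite, 'm::finite, 'p::finite, 'q::finite,
      'r::finite, 'v::finite, 'c::finite, 'k::finite) sys \<Rightarrow>
     real^'m^'q" where
  "bD11 S = D11 S + D1v S ** Dvw S"

definition bD12 ::
    "('n::finite, 'm::finite, 'p::finite, 'q::finite,
      'r::finite, 'v::finite, 'c::finite, 'k::finite) sys \<Rightarrow>
     real^'p^'q" where
  "bD12 S = D12 S + D1v S ** Dvu S"

definition bC20 ::
    "('n::finite, 'm::finite, 'p::finite, 'q::finite,
      'r::finite, 'v::finite, 'c::finite, 'k::finite) sys \<Rightarrow>
     real^'n^'r" where
  "bC20 S = C2 S + D2v S ** Cvx S"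

definition bD21 ::
    "('n::finite, 'm::finite, 'p::finite, 'q::finite,
      'r::finite, 'v::finite, 'c::finite, 'k::finite) sys \<Rightarrow>
     real^'m^'r" where
  "bD21 S = D21 S + D2v S ** Dvw S"

definition bD22 ::
    "('n::finite, 'm::finite, 'p::finite, 'q::finite,
      'r::finite, 'v::finite, 'c::finite, 'k::finite) sys \<Rightarrow>
     real^'p^'r" where
  "bD22 S = D22 S + D2v S ** Dvu S"

text \<open>
  \<open>opT\<close> returns the representative given by the defining formula at every \<open>s\<close>, which is the absolutely
  continuous one.
\<close>

definition opT ::
    "('n::finite, 'm::finite, 'p::finite, 'q::finite,
      'r::finite, 'v::finite, 'c::finite, 'k::finite) sys \<Rightarrow>
     (real^'n) \<times> (real \<Rightarrow> real^'c) \<Rightarrow>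
     (real^'n) \<times> (real \<Rightarrow> real^'c)" where
  "opT S X = (fst X, \<lambda>s. bT0 S *v fst X
     + (LINT \<theta>|lebesgue_on {-1..s}. bTa S s \<theta> *v snd X \<theta>)
     + (LINT \<theta>|lebesgue_on {s..0}. bTb S s \<theta> *v snd X \<theta>))"

definition opA ::
    "('n::finite, 'm::finite, 'p::finite, 'q::finite,
      'r::finite, 'v::finite, 'c::finite, 'k::finite) sys \<Rightarrow>
     (real^'n) \<times> (real \<Rightarrow> real^'c) \<Rightarrow>
     (real^'n) \<times> (real \<Rightarrow> real^'c)" where
  "opA S X = (bA0 S *v fst X + (LINT \<theta>|lebesgue_on {-1..0}. bA S \<theta> *v snd X \<theta>),
     \<lambda>s. Itau S *v snd X s)"

definition opB1 ::
    "('n::finite, 'm::finite, 'p::finite, 'q::finite,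
      'r::finite, 'v::finite, 'c::finite, 'k::finite) sys \<Rightarrow>
     real^'m \<Rightarrow> (real^'n) \<times> (real \<Rightarrow> real^'c)" where
  "opB1 S \<omega> = (bB1 S *v \<omega>, \<lambda>s. 0)"

definition opB2 ::
    "('n::finite, 'm::finite, 'p::finite, 'q::finite,
      'r::finite, 'v::finite, 'c::finite, 'k::finite) sys \<Rightarrow>
     real^'p \<Rightarrow> (real^'n) \<times> (real \<Rightarrow> real^'c)" where
  "opB2 S \<mu> = (bB2 S *v \<mu>, \<lambda>s. 0)"

definition opBT1 ::
    "('n::finite, 'm::finite, 'p::finite, 'q::finite,
      'r::finite, 'v::finite, 'c::finite, 'k::finite) sys \<Rightarrow>
     real^'m \<Rightarrow> (real^'n) \<times> (real \<Rightarrow> real^'c)" where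
  "opBT1 S \<omega> = (0, \<lambda>s. bT1 S *v \<omega>)"

definition opBT2 ::
    "('n::finite, 'm::finite, 'p::finite, 'q::finite,
      'r::finite, 'v::finite, 'c::finite, 'k::finite) sys \<Rightarrow>
     real^'p \<Rightarrow> (real^'n) \<times> (real \<Rightarrow> real^'c)" where
  "opBT2 S \<mu> = (0, \<lambda>s. bT2 S *v \<mu>)"

definition opC1 ::
    "('n::finite, 'm::finite, 'p::finite, 'q::finite,
      'r::finite, 'v::finite, 'c::finite, 'k::finite) sys \<Rightarrow>
     (real^'n) \<times> (real \<Rightarrow> real^'c) \<Rightarrow> real^'q" where
  "opC1 S X = bC10 S *v fst X + (LINT \<theta>|lebesgue_on {-1..0}. bC11 S \<theta> *v snd X \<theta>)"

definition opC2 ::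
    "('n::finite, 'm::finite, 'p::finite, 'q::finite,
      'r::finite, 'v::finite, 'c::finite, 'k::finite) sys \<Rightarrow>
     (real^'n) \<times> (real \<Rightarrow> real^'c) \<Rightarrow> real^'r" where
  "opC2 S X = bC20 S *v fst X + (LINT \<theta>|lebesgue_on {-1..0}. bC21 S \<theta> *v snd X \<theta>)"

text \<open>
  Here \<open>b\<close> is the time derivative of \<open>\<B>\<^bsub>T1\<^esub> w + \<B>\<^bsub>T2\<^esub> u\<close>; \<open>w\<close> and \<open>u\<close> themselves need not
  be differentiable.
\<close>

definition satisfies_PIE ::
    "('n::finite, 'm::finite, 'p::finite, 'q::finite,
      'r::finite, 'v::finite, 'c::finite, 'k::finite) sys \<Rightarrow>
     (real \<Rightarrow> real^'p) \<Rightarrow> (real \<Rightarrow> real^'m) \<Rightarrow>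
     (real^'n) \<times> (real \<Rightarrow> real^'c) \<Rightarrow> (real \<Rightarrow> (real^'n) \<times> (real \<Rightarrow> real^'c)) \<Rightarrow>
     (real \<Rightarrow> real^'r) \<Rightarrow> (real \<Rightarrow> real^'q) \<Rightarrow> bool" where
  "satisfies_PIE S u w X0 X y z \<longleftrightarrow>
     X0 \<in> Z_space \<and> Z_eq (X 0) X0 \<and>
     (\<forall>t\<ge>0. \<exists>d b. frechet_deriv Z_space Z_norm X d t \<and>
        frechet_deriv Z_space Z_norm (\<lambda>r. opBT1 S (w r) + opBT2 S (u r)) b t \<and>
        Z_eq (opT S d + b) (opA S (X t) + opB1 S (w t) + opB2 S (u t))) \<and>
     (\<forall>t\<ge>0. z t = opC1 S (X t) + bD11 S *v w t + bD12 S *v u t) \<and>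
     (\<forall>t\<ge>0. y t = opC2 S (X t) + bD21 S *v w t + bD22 S *v u t)"

end

theory Submission
  imports Defs
begin

text \<open>
  On \<open>[-1,0]\<close> a function \<open>f\<close> with weak derivative \<open>g\<close> is \<open>f 0 - \<integral>\<^bsub>s\<^esub>\<^bsup>0\<^esup> g\<close>. Inserting this into the
  output \<open>v\<close> of the delay channel and exchanging the order of integration turns \<open>v\<close> into
  \<open>\<Sum>\<^sub>i Chat\<^sub>i f 0 - \<integral> N g\<close>, where \<open>N\<close> is the primitive of the delay kernel with \<open>N (-1) = C\<^sub>v\<close> and
  \<open>N 0 = \<Sum>\<^sub>i Chat\<^sub>i\<close>. Together with the boundary condition at \<open>s = 0\<close> this is a linear equation for
  \<open>v\<close> with matrix \<open>I - \<Sum>\<^sub>i Chat\<^sub>i D\<^bsub>rvi\<^esub>\<close>, whose solution is \<open>v = C\<^bsub>vx\<^esub> x + D\<^bsub>vw\<^esub> w + D\<^bsub>vu\<^esub> u + \<integral> C\<^sub>I g\<close>.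
  Hence the boundary condition and the definition of \<open>v\<close> hold for \<open>(x, f)\<close> iff
  \<open>(x, f) = T (x, g) + B\<^bsub>T1\<^esub> w + B\<^bsub>T2\<^esub> u\<close>, and both directions are obtained by differentiating this
  identity in time, using that \<open>T\<close> is bounded. From the PIE to the ODE-PDE, the derivative of
  \<open>B\<^bsub>T1\<^esub> w + B\<^bsub>T2\<^esub> u\<close> has to be constant in \<open>s\<close>, because the constants are closed in \<open>L\<^sub>2\<close>.
\<close>

section \<open>Functions in \<open>L\<^sub>2\<close> and \<open>W\<^bsup>1,2\<^esup>\<close>\<close>

lemma norm_sq_add_le:
  fixes x y :: "'a::real_normed_vector"
  shows "(norm (x + y))\<^sup>2 \<le> 2 * (norm x)\<^sup>2 + 2 * (norm y)\<^sup>2"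
proof -
  have "(norm (x + y))\<^sup>2 \<le> (norm x + norm y)\<^sup>2"
    by (simp add: norm_triangle_ineq power_mono)
  also have "\<dots> \<le> 2 * (norm x)\<^sup>2 + 2 * (norm y)\<^sup>2"
    using sum_squares_bound[of "norm x" "norm y"] by (simp add: power2_sum)
  finally show ?thesis .
qed

lemma tendsto_zero_if_sq:
  fixes f :: "'a \<Rightarrow> real"
  assumes "((\<lambda>r. (f r)\<^sup>2) \<longlongrightarrow> 0) F"
  shows "(f \<longlongrightarrow> 0) F"
  using tendsto_real_sqrt[OF assms] by (simp add: tendsto_rabs_zero_iff)

lemma tendsto_zero_sq:
  fixes f :: "'a \<Rightarrow> real"
  assumes "(f \<longlongrightarrow> 0) F"
  shows "((\<lambda>r. (f r)\<^sup>2) \<longlongrightarrow> 0) F"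
  using tendsto_power[OF assms, of 2] by simp

lemma L2_integrable_sq: "f \<in> L2 I \<Longrightarrow> integrable (lebesgue_on I) (\<lambda>s. (norm (f s))\<^sup>2)"
  by (simp add: L2_def)

lemma L2_measurable: "f \<in> L2 I \<Longrightarrow> f \<in> borel_measurable (lebesgue_on I)"
  by (simp add: L2_def)

lemma L2_norm_sq: "(L2_norm I f)\<^sup>2 = (LINT s|lebesgue_on I. (norm (f s))\<^sup>2)"
  by (simp add: L2_norm_def)

lemma L2_add:
  assumes "f \<in> L2 I" "g \<in> L2 I"
  shows "(\<lambda>s. f s + g s) \<in> L2 I"
proof -
  have "integrable (lebesgue_on I) (\<lambda>s. 2 * (norm (f s))\<^sup>2 + 2 * (norm (g s))\<^sup>2)"
    using assms by (intro Bochner_Integration.integrable_add integrable_mult_right) (auto simp: L2_def)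
  then have "integrable (lebesgue_on I) (\<lambda>s. (norm (f s + g s))\<^sup>2)"
    by (rule Bochner_Integration.integrable_bound)
       (use assms norm_sq_add_le in \<open>auto simp: L2_def\<close>)
  then show ?thesis using assms by (auto simp: L2_def)
qed

lemma L2_scaleR:
  assumes "f \<in> L2 I"
  shows "(\<lambda>s. c *\<^sub>R f s) \<in> L2 I"
  using assms by (auto simp: L2_def power_mult_distrib)

lemma L2_diff:
  assumes "f \<in> L2 I" "g \<in> L2 I"
  shows "(\<lambda>s. f s - g s) \<in> L2 I"
  using L2_add[OF assms(1) L2_scaleR[OF assms(2), of "-1"]] by simp

lemma L2_norm_cong:
  assumes "\<And>s. s \<in> I \<Longrightarrow> f s = g s"
  shows "L2_norm I f = L2_norm I g"
  unfolding L2_norm_def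
  using assms by (auto intro!: arg_cong[where f=sqrt] Bochner_Integration.integral_cong)

lemma L2_norm_cong_AE:
  assumes "f \<in> L2 I" "g \<in> L2 I" "AE s in lebesgue_on I. f s = g s"
  shows "L2_norm I f = L2_norm I g"
  unfolding L2_norm_def
  using assms(3) L2_integrable_sq[OF assms(1)] L2_integrable_sq[OF assms(2)]
  by (auto intro!: arg_cong[where f=sqrt] integral_cong_AE)

text \<open>A substitute for the triangle inequality: estimates are carried out on squared norms,
  and the factor 2 is harmless because they serve only boundedness and convergence to zero.\<close>

lemma L2_norm_sq_add_le:
  assumes "f \<in> L2 I" "g \<in> L2 I"
  shows "(L2_norm I (\<lambda>s. f s + g s))\<^sup>2 \<le> 2 * (L2_norm I f)\<^sup>2 + 2 * (L2_norm I g)\<^sup>2"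
proof -
  have "(L2_norm I (\<lambda>s. f s + g s))\<^sup>2 \<le> (LINT s|lebesgue_on I. 2 * (norm (f s))\<^sup>2 + 2 * (norm (g s))\<^sup>2)"
    unfolding L2_norm_sq using assms L2_add[OF assms] norm_sq_add_le
    by (intro integral_mono Bochner_Integration.integrable_add integrable_mult_right)
       (auto simp: L2_def)
  also have "\<dots> = 2 * (L2_norm I f)\<^sup>2 + 2 * (L2_norm I g)\<^sup>2"
    unfolding L2_norm_sq using assms by (subst Bochner_Integration.integral_add) (auto simp: L2_def)
  finally show ?thesis .
qed

lemma L2_norm_minus: "L2_norm I (\<lambda>s. - f s) = L2_norm I f"
  by (simp add: L2_norm_def)

lemma L2_norm_sq_diff_le:
  assumes "f \<in> L2 I" "g \<in> L2 I"
  shows "(L2_norm I (\<lambda>s. f s - g s))\<^sup>2 \<le> 2 * (L2_norm I f)\<^sup>2 + 2 * (L2_norm I g)\<^sup>2"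
  using L2_norm_sq_add_le[OF assms(1) L2_scaleR[OF assms(2), of "-1"]] by (simp add: L2_norm_minus)

lemma L2_norm_zero_AE:
  assumes "f \<in> L2 I" "L2_norm I f = 0"
  shows "AE s in lebesgue_on I. f s = 0"
proof -
  have "AE s in lebesgue_on I. (norm (f s))\<^sup>2 = 0"
    using assms by (subst integral_nonneg_eq_0_iff_AE[symmetric]) (auto simp: L2_def L2_norm_def)
  then show ?thesis by simp
qed

section \<open>The interval [-1,0] as a measure space of total mass 1\<close>

abbreviation leb_I :: "real measure" where "leb_I \<equiv> lebesgue_on {-1..0}"

lemma finite_measure_leb_I: "finite_measure leb_I"
  by (simp add: finite_measure_lebesgue_on)

lemma measure_leb_I: "measure leb_I (space leb_I) = 1"
  by (simp add: measure_restrict_space)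

lemma integrable_leb_I_const [simp]: "integrable leb_I (\<lambda>_. c :: 'a::{banach,second_countable_topology})"
  using finite_measure_leb_I by (rule finite_measure.integrable_const)

lemma L2_integrable:
  assumes "f \<in> L2 {-1..0}"
  shows "integrable leb_I f"
proof -
  have "integrable leb_I (\<lambda>s. norm (f s))"
    by (rule finite_measure.square_integrable_imp_integrable[OF finite_measure_leb_I
          measurable_compose[OF L2_measurable[OF assms] borel_measurable_norm] L2_integrable_sq[OF assms]])
  then show ?thesis
    using L2_measurable[OF assms] by (simp add: integrable_norm_iff)
qed

text \<open>Since [-1,0] has measure 1, this is the nonnegativity of the variance of
  \<open>norm (f s)\<close>, whose mean is \<open>m\<close>.\<close>

lemma L1_sq_le_L2:
  assumes "f \<in> L2 {-1..0}"
  shows "(LINT s|leb_I. norm (f s))\<^sup>2 \<le> (L2_norm {-1..0} f)\<^sup>2"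
proof -
  define m where "m = (LINT s|leb_I. norm (f s))"
  have i: "integrable leb_I (\<lambda>s. norm (f s))" "integrable leb_I (\<lambda>s. (norm (f s))\<^sup>2)"
    using L2_integrable[OF assms] L2_integrable_sq[OF assms] by auto
  have "0 \<le> (LINT s|leb_I. (norm (f s) - m)\<^sup>2)" by simp
  also have "\<dots> = (LINT s|leb_I. (norm (f s))\<^sup>2 + m\<^sup>2 - 2 * m * norm (f s))"
    by (simp add: power2_diff algebra_simps)
  also have "\<dots> = (L2_norm {-1..0} f)\<^sup>2 + m\<^sup>2 - 2 * m * m"
    using i by (simp add: L2_norm_sq measure_leb_I m_def measure_restrict_space)
  finally show ?thesis by (simp add: m_def power2_eq_square)
qed

lemma L2_continuous:
  assumes "continuous_on {-1..0} f"
  shows "f \<in> L2 {-1..0}"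
proof -
  have "continuous_on {-1..0} (\<lambda>s. (norm (f s))\<^sup>2)" using assms by (intro continuous_intros)
  then show ?thesis using assms
    by (auto simp: L2_def intro!: continuous_imp_measurable_on_sets_lebesgue continuous_imp_integrable_real)
qed

lemma L2_const: "(\<lambda>_. c) \<in> L2 {-1..0}"
  by (intro L2_continuous continuous_intros)

lemma L2_norm_const: "(L2_norm {-1..0} (\<lambda>_. c))\<^sup>2 = (norm c)\<^sup>2"
  by (simp add: L2_norm_sq measure_restrict_space)

text \<open>
  The sets \<open>A\<close> with \<open>\<integral>\<^sub>A g = 0\<close> form a Dynkin system, which here contains the half lines.
\<close>

lemma AE_zero_if_subinterval_integrals_zero:
  fixes g :: "real \<Rightarrow> 'a::euclidean_space"
  assumes g: "integrable (lebesgue_on {a..b}) g"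
    and z: "\<And>t. a \<le> t \<Longrightarrow> t \<le> b \<Longrightarrow> (LINT s|lebesgue_on {a..t}. g s) = 0"
  shows "AE s in lebesgue_on {a..b}. g s = 0"
proof (cases "a \<le> b")
  case False
  then have "space (lebesgue_on {a..b}) = {}" by simp
  then show ?thesis by (metis AE_I2 empty_iff)
next
  case ab: True
  let ?M = "lebesgue_on {a..b}"
  have sM: "A \<inter> {a..b} \<in> sets ?M" if "A \<in> sets lebesgue" for A
    using that by (simp add: sets_restrict_space) (metis Int_commute image_eqI)
  have iA: "integrable ?M (\<lambda>s. indicator A s *\<^sub>R g s)" if "A \<in> sets lebesgue" for A
  proof -
    have "integrable ?M (\<lambda>s. indicator (A \<inter> {a..b}) s *\<^sub>R g s)"
      by (rule integrable_mult_indicator[OF sM[OF that] g])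
    then show ?thesis
      by (rule Bochner_Integration.integrable_cong[THEN iffD1, rotated 2]) (auto simp: indicator_def)
  qed
  \<comment> \<open>The case \<open>t = b\<close> of the hypothesis; it is what makes the family of
    sets closed under complements.\<close>
  have gi: "(LINT s|?M. g s) = 0" using z[of b] ab by simp
  have st: "Int_stable (range (atMost :: real \<Rightarrow> _))"
    by (auto simp: Int_stable_def)
  have bor: "(LINT s|?M. indicator A s *\<^sub>R g s) = 0" if A: "A \<in> sigma_sets UNIV (range atMost)" for A :: "real set"
  proof (rule sigma_sets_induct_disjoint[OF st _ A, where P="\<lambda>A. (LINT s|?M. indicator A s *\<^sub>R g s) = 0"])
    fix A :: "real set" assume "A \<in> range atMost"
    then obtain t where A: "A = {..t}" by auto
    have eq: "(LINT s|?M. indicator A s *\<^sub>R g s) = (LINT s|lebesgue_on ({..t} \<inter> {a..b}). g s)"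
      by (subst Lebesgue_Measure.integral_restrict_Int[symmetric])
         (auto simp: A indicator_def intro!: Bochner_Integration.integral_cong)
    show "(LINT s|?M. indicator A s *\<^sub>R g s) = 0"
    proof (cases "t < a")
      case True
      then have "{..t} \<inter> {a..b} = {}" by auto
      then show ?thesis unfolding eq by (simp only: integral_lebesgue_on_empty)
    next
      case False
      then have "{..t} \<inter> {a..b} = {a..min t b}" by auto
      then show ?thesis unfolding eq using z[of "min t b"] ab False by simp
    qed
  next
    fix A :: "real set" assume A: "A \<in> sigma_sets UNIV (range atMost)"
      and IH: "(LINT s|?M. indicator A s *\<^sub>R g s) = 0"
    have "A \<in> sets lebesgue" using A by (metis borel_eq_atMost sets_measure_of sets_completionI_sets sets_lborel top_greatest Pow_UNIV)
    have "(LINT s|?M. indicator (UNIV - A) s *\<^sub>R g s) = (LINT s|?M. g s - indicator A s *\<^sub>R g s)"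
      by (intro Bochner_Integration.integral_cong) (auto simp: indicator_def)
    also have "\<dots> = 0" using iA[OF \<open>A \<in> sets lebesgue\<close>] g IH gi by simp
    finally show "(LINT s|?M. indicator (UNIV - A) s *\<^sub>R g s) = 0" .
  next
    fix A :: "nat \<Rightarrow> real set" assume d: "disjoint_family A"
      and A: "range A \<subseteq> sigma_sets UNIV (range atMost)"
      and IH: "\<And>i. (LINT s|?M. indicator (A i) s *\<^sub>R g s) = 0"
    have Al: "A i \<in> sets lebesgue" for i
      using A by (metis borel_eq_atMost sets_measure_of sets_completionI_sets sets_lborel top_greatest Pow_UNIV range_subsetD)
    let ?B = "\<lambda>i. A i \<inter> {a..b}"
    have eqB: "(LINT s|?M. indicator (X \<inter> {a..b}) s *\<^sub>R g s) = (LINT s|?M. indicator X s *\<^sub>R g s)" for X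
      by (intro Bochner_Integration.integral_cong) (auto simp: indicator_def)
    have "(LINT s:(\<Union>i. ?B i)|?M. g s) = (\<Sum>i. (LINT s:?B i|?M. g s))"
    proof (rule lebesgue_integral_countable_add)
      show "set_integrable ?M (\<Union>i. ?B i) g"
        unfolding set_integrable_def
        using Al sM by (intro integrable_mult_indicator g sets.countable_UN) auto
      show "?B i \<inter> ?B j = {}" if "i \<noteq> j" for i j
        using d that by (auto simp: disjoint_family_on_def)
    qed (use sM[OF Al] in auto)
    also have "\<dots> = 0" using IH by (simp add: set_lebesgue_integral_def eqB)
    also have "(\<Union>i. ?B i) = (\<Union>i. A i) \<inter> {a..b}" by auto
    finally show "(LINT s|?M. indicator (\<Union>i. A i) s *\<^sub>R g s) = 0"
      by (simp add: set_lebesgue_integral_def eqB)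
  qed auto
  interpret finite_measure ?M by (simp add: finite_measure_lebesgue_on)
  show ?thesis
  proof (rule density_zero[OF g])
    fix A assume "A \<in> sets ?M"
    then have "A \<in> sets lebesgue" by (auto simp: sets_restrict_space)
    \<comment> \<open>A Lebesgue set differs from a Borel set by a null set, which the integral does
      not see, so the Borel case suffices.\<close>
    then obtain S N N' where A: "A = S \<union> N" "N \<subseteq> N'" "N' \<in> null_sets lborel" "S \<in> sets lborel"
      by (rule sets_completionE)
    have "N' \<in> null_sets lebesgue" using A(3) by (simp add: null_sets_completionI)
    then have "AE s in lebesgue. s \<notin> N'" by (rule AE_not_in)
    then have "AE s in ?M. s \<notin> N'" by (auto simp: AE_restrict_space_iff)
    then have "(LINT s|?M. indicator A s *\<^sub>R g s) = (LINT s|?M. indicator S s *\<^sub>R g s)"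
      using iA[OF \<open>A \<in> sets lebesgue\<close>] iA[of S] A
      by (intro integral_cong_AE) (auto simp: indicator_def elim!: eventually_mono)
    also have "\<dots> = 0" using A(4) by (intro bor) (simp add: borel_eq_atMost)
    finally show "(LINT s:A|?M. g s) = 0" by (simp add: set_lebesgue_integral_def)
  qed
qed

section \<open>Weak derivatives on [-1,0]\<close>

lemma has_wderiv_L2: "has_wderiv I f g \<Longrightarrow> g \<in> L2 I"
  by (simp add: has_wderiv_def)

lemma has_wderivD:
  assumes "has_wderiv I f g" "s \<in> I" "t \<in> I" "s \<le> t"
  shows "f t = f s + (LINT \<theta>|lebesgue_on {s..t}. g \<theta>)"
  using assms unfolding has_wderiv_def by blast

text \<open>Normalisation at the right end point, where the boundary condition of the transport
  equation sits; additivity of the integral recovers the increments over all subintervals.\<close>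

lemma has_wderiv_interval_iff:
  fixes f :: "real \<Rightarrow> 'a::euclidean_space"
  shows "has_wderiv {-1..0} f g \<longleftrightarrow>
    g \<in> L2 {-1..0} \<and> (\<forall>s\<in>{-1..0}. f s = f 0 - (LINT \<theta>|lebesgue_on {s..0}. g \<theta>))"
proof (intro iffI conjI ballI)
  assume "has_wderiv {-1..0} f g"
  then show "g \<in> L2 {-1..0}"
    "\<And>s. s \<in> {-1..0} \<Longrightarrow> f s = f 0 - (LINT \<theta>|lebesgue_on {s..0}. g \<theta>)"
    using has_wderiv_L2 has_wderivD[of "{-1..0}" f g _ 0] by (auto simp: algebra_simps)
next
  assume *: "g \<in> L2 {-1..0} \<and> (\<forall>s\<in>{-1..0}. f s = f 0 - (LINT \<theta>|lebesgue_on {s..0}. g \<theta>))"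
  then have i: "integrable leb_I g" by (simp add: L2_integrable)
  show "has_wderiv {-1..0} f g"
    unfolding has_wderiv_def
  proof (intro conjI ballI impI)
    fix s t :: real assume st: "s \<in> {-1..0}" "t \<in> {-1..0}" "s \<le> t"
    have "(LINT \<theta>|lebesgue_on {s..0}. g \<theta>) = (LINT \<theta>|lebesgue_on {s..t}. g \<theta>) + (LINT \<theta>|lebesgue_on {t..0}. g \<theta>)"
      using st by (intro integral_combine integrable_subinterval[OF i]) auto
    moreover have "f s = f 0 - (LINT \<theta>|lebesgue_on {s..0}. g \<theta>)" "f t = f 0 - (LINT \<theta>|lebesgue_on {t..0}. g \<theta>)"
      using * st by blast+
    ultimately show "f t = f s + (LINT \<theta>|lebesgue_on {s..t}. g \<theta>)"
      by simp
  qed (use * in auto)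
qed

text \<open>The difference of two weak derivatives integrates to zero over every [-1,t].\<close>

lemma has_wderiv_unique:
  assumes "has_wderiv {-1..0} f g" "has_wderiv {-1..0} f h"
  shows "AE s in leb_I. g s = h s"
proof -
  have gh: "g \<in> L2 {-1..0}" "h \<in> L2 {-1..0}" using assms has_wderiv_L2 by blast+
  have i: "integrable leb_I g" "integrable leb_I h" using gh by (auto simp: L2_integrable)
  have "AE s in leb_I. g s - h s = 0"
  proof (rule AE_zero_if_subinterval_integrals_zero)
    fix t :: real assume t: "-1 \<le> t" "t \<le> 0"
    have "integrable (lebesgue_on {-1..t}) g" "integrable (lebesgue_on {-1..t}) h"
      using t by (auto intro: integrable_subinterval[OF i(1)] integrable_subinterval[OF i(2)])
    moreover have "f t = f (-1) + (LINT \<theta>|lebesgue_on {-1..t}. g \<theta>)"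
      "f t = f (-1) + (LINT \<theta>|lebesgue_on {-1..t}. h \<theta>)"
      using t by (auto intro!: has_wderivD[OF assms(1)] has_wderivD[OF assms(2)])
    ultimately show "(LINT s|lebesgue_on {-1..t}. g s - h s) = 0" by simp
  qed (use i in auto)
  then show ?thesis by simp
qed

lemma has_wderiv_cong_AE:
  assumes "has_wderiv {-1..0} f g" "h \<in> L2 {-1..0}" "AE s in leb_I. g s = h s"
  shows "has_wderiv {-1..0} f h"
proof -
  have i: "integrable leb_I g" "integrable leb_I h" using assms by (auto simp: L2_integrable has_wderiv_L2)
  have "(LINT \<theta>|lebesgue_on {s..0}. g \<theta>) = (LINT \<theta>|lebesgue_on {s..0}. h \<theta>)" if "s \<in> {-1..0}" for s
  proof (rule integral_cong_AE)
    have "integrable (lebesgue_on {s..0}) g" "integrable (lebesgue_on {s..0}) h"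
      using that by (auto intro: integrable_subinterval[OF i(1)] integrable_subinterval[OF i(2)])
    then show "g \<in> borel_measurable (lebesgue_on {s..0})" "h \<in> borel_measurable (lebesgue_on {s..0})"
      by auto
    show "AE x in lebesgue_on {s..0}. g x = h x"
      using assms(3) that by (auto simp: AE_restrict_space_iff elim!: eventually_mono)
  qed
  then show ?thesis using assms unfolding has_wderiv_interval_iff by metis
qed

lemma has_wderiv_cong:
  assumes "has_wderiv {-1..0} f g" "\<And>s. s \<in> {-1..0} \<Longrightarrow> f s = h s"
  shows "has_wderiv {-1..0} h g"
  using assms unfolding has_wderiv_def by metis

text \<open>The combination \<open>c *\<^sub>R f - g\<close> is all that a difference quotient minus
  its limit requires: it is applied with \<open>c = 1\<close> and then with \<open>c\<close> the
  inverse of the time step. The linearity lemmas for \<open>CI_int\<close> and \<open>T_end\<close>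
  have the same shape for this reason.\<close>

lemma has_wderiv_scaleR_diff:
  assumes "has_wderiv {-1..0} f f'" "has_wderiv {-1..0} g g'"
  shows "has_wderiv {-1..0} (\<lambda>s. c *\<^sub>R f s - g s) (\<lambda>s. c *\<^sub>R f' s - g' s)"
proof -
  have L: "f' \<in> L2 {-1..0}" "g' \<in> L2 {-1..0}" using assms has_wderiv_L2 by blast+
  then have i: "integrable leb_I f'" "integrable leb_I g'" by (auto simp: L2_integrable)
  show ?thesis
    unfolding has_wderiv_interval_iff
  proof (intro conjI ballI L2_diff L2_scaleR L)
    fix s :: real assume s: "s \<in> {-1..0}"
    have "integrable (lebesgue_on {s..0}) f'" "integrable (lebesgue_on {s..0}) g'"
      using s by (auto intro: integrable_subinterval[OF i(1)] integrable_subinterval[OF i(2)])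
    moreover have "f 0 = f s + (LINT \<theta>|lebesgue_on {s..0}. f' \<theta>)" "g 0 = g s + (LINT \<theta>|lebesgue_on {s..0}. g' \<theta>)"
      using s by (auto intro!: has_wderivD[OF assms(1)] has_wderivD[OF assms(2)])
    ultimately show "c *\<^sub>R f s - g s = c *\<^sub>R f 0 - g 0 - (LINT \<theta>|lebesgue_on {s..0}. c *\<^sub>R f' \<theta> - g' \<theta>)"
      by (simp add: algebra_simps)
  qed
qed

lemma has_wderiv_norm_le:
  assumes "has_wderiv {-1..0} f g" "s \<in> {-1..0}"
  shows "norm (f s) \<le> norm (f 0) + (LINT s|leb_I. norm (g s))"
proof -
  have i: "integrable leb_I g" using assms by (simp add: L2_integrable has_wderiv_L2)
  then have i': "integrable (lebesgue_on {s..0}) (\<lambda>x. norm (g x))" "integrable (lebesgue_on {-1..s}) (\<lambda>x. norm (g x))"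
    using assms by (auto intro: integrable_subinterval[OF integrable_norm[OF i]])
  have "f s = f 0 - (LINT \<theta>|lebesgue_on {s..0}. g \<theta>)"
    using assms unfolding has_wderiv_interval_iff by blast
  then have "norm (f s) \<le> norm (f 0) + norm (LINT \<theta>|lebesgue_on {s..0}. g \<theta>)"
    by (simp add: norm_triangle_ineq4)
  also have "norm (LINT \<theta>|lebesgue_on {s..0}. g \<theta>) \<le> (LINT s|lebesgue_on {s..0}. norm (g s))"
    by (rule integral_norm_bound)
  also have "\<dots> \<le> (LINT s|leb_I. norm (g s))"
    using integral_combine[OF integrable_norm[OF i], of s] assms
    by (simp add: Bochner_Integration.integral_nonneg)
  finally show ?thesis by simp
qed

lemma has_wderiv_continuous_on:
  fixes f :: "real \<Rightarrow> 'a::euclidean_space"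
  assumes "has_wderiv {-1..0} f g"
  shows "continuous_on {-1..0} f"
proof -
  have "continuous_on {-1..0} (\<lambda>t. f (-1) + (LINT \<theta>|lebesgue_on {-1..t}. g \<theta>))"
    using assms by (intro continuous_intros indefinite_integral_continuous_real L2_integrable has_wderiv_L2)
  then show ?thesis
    by (rule continuous_on_eq) (rule has_wderivD[OF assms, symmetric]; simp)
qed

text \<open>On a compact interval absolute continuity gives continuity, hence square integrability;
  so a weak derivative alone places \<open>f\<close> in \<open>W12\<close>.\<close>

lemma has_wderiv_imp_L2: "has_wderiv {-1..0} f g \<Longrightarrow> f \<in> L2 {-1..0}"
  by (intro L2_continuous has_wderiv_continuous_on)

lemma has_wderiv_imp_W12: "has_wderiv {-1..0} f g \<Longrightarrow> f \<in> W12 {-1..0}"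
  by (auto simp: W12_def has_wderiv_imp_L2)

lemma has_wderiv_wderiv: "f \<in> W12 I \<Longrightarrow> has_wderiv I f (wderiv I f)"
  unfolding W12_def wderiv_def by (auto intro!: someI_ex[of "has_wderiv I f"])

lemma wderiv_AE_eq:
  assumes "has_wderiv {-1..0} f g"
  shows "AE s in leb_I. wderiv {-1..0} f s = g s"
  using assms has_wderiv_imp_W12 has_wderiv_unique has_wderiv_wderiv by blast

section \<open>Norm estimates and limits in the function spaces\<close>

lemma W12_norm_sq: 
  assumes "has_wderiv {-1..0} f g"
  shows "(W12_norm {-1..0} f)\<^sup>2 = (L2_norm {-1..0} f)\<^sup>2 + (L2_norm {-1..0} g)\<^sup>2"
proof -
  have "L2_norm {-1..0} (wderiv {-1..0} f) = L2_norm {-1..0} g"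
    using assms wderiv_AE_eq
    by (intro L2_norm_cong_AE) (auto intro: has_wderiv_L2 has_wderiv_wderiv has_wderiv_imp_W12)
  then show ?thesis by (simp add: W12_norm_def)
qed

lemma Z_norm_sq: "(Z_norm X)\<^sup>2 = (norm (fst X))\<^sup>2 + (L2_norm {-1..0} (snd X))\<^sup>2"
  by (simp add: Z_norm_def)

text \<open>The end value and the L1 norm of \<open>g\<close> bound \<open>f\<close> uniformly, and
  the L1 norm is at most the L2 norm. Hence the end value at 0 and the derivative together control
  the whole \<open>W12\<close> norm.\<close>

lemma L2_norm_sq_le_wderiv:
  assumes "has_wderiv {-1..0} f g"
  shows "(L2_norm {-1..0} f)\<^sup>2 \<le> 2 * (norm (f 0))\<^sup>2 + 2 * (L2_norm {-1..0} g)\<^sup>2"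
proof -
  let ?m = "LINT s|leb_I. norm (g s)"
  let ?c = "2 * (norm (f 0))\<^sup>2 + 2 * ?m\<^sup>2"
  have "(norm (f s))\<^sup>2 \<le> ?c" if "s \<in> {-1..0}" for s
  proof -
    have "(norm (f s))\<^sup>2 \<le> (norm (f 0) + ?m)\<^sup>2"
      using has_wderiv_norm_le[OF assms that] by (simp add: power_mono)
    also have "\<dots> \<le> ?c" using norm_sq_add_le[of "norm (f 0)" ?m] by simp
    finally show ?thesis .
  qed
  then have "(LINT s|leb_I. (norm (f s))\<^sup>2) \<le> (LINT s|leb_I. ?c)"
    using L2_integrable_sq[OF has_wderiv_imp_L2[OF assms]]
    by (intro integral_mono) auto
  also have "\<dots> = ?c" by (simp add: measure_restrict_space)
  finally show ?thesis
    using L1_sq_le_L2[OF has_wderiv_L2[OF assms]] by (simp add: L2_norm_sq)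
qed

text \<open>The constants are closed in L2: taking the mean over [-1,0] does not increase the norm,
  so \<open>c r\<close> converges to the mean of \<open>b\<close>, and \<open>b\<close> must
  coincide with that mean almost everywhere.\<close>

lemma tendsto_L2_const_limit:
  assumes F: "F \<noteq> bot"
    and b: "b \<in> L2 {-1..0}"
    and lim: "((\<lambda>r. L2_norm {-1..0} (\<lambda>s. c r - b s)) \<longlongrightarrow> 0) F"
  obtains \<beta> where "AE s in leb_I. b s = \<beta>" "(c \<longlongrightarrow> \<beta>) F"
proof -
  define \<beta> where "\<beta> = (LINT s|leb_I. b s)"
  have i: "integrable leb_I b" using b by (rule L2_integrable)
  have cb: "(\<lambda>s. c r - b s) \<in> L2 {-1..0}" for r by (intro L2_diff L2_const b)
  have le: "norm (c r - \<beta>) \<le> L2_norm {-1..0} (\<lambda>s. c r - b s)" for r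
  proof -
    have "c r - \<beta> = (LINT s|leb_I. c r - b s)" using i by (simp add: \<beta>_def measure_restrict_space)
    then have "norm (c r - \<beta>) \<le> (LINT s|leb_I. norm (c r - b s))" by (simp add: integral_norm_bound)
    also have "\<dots> \<le> L2_norm {-1..0} (\<lambda>s. c r - b s)"
      using L1_sq_le_L2[OF cb] by (rule power2_le_imp_le) (simp add: L2_norm_def)
    finally show ?thesis .
  qed
  have "((\<lambda>r. norm (c r - \<beta>)) \<longlongrightarrow> 0) F"
    by (rule tendsto_sandwich[OF _ _ tendsto_const lim]) (use le in auto)
  then have c: "(c \<longlongrightarrow> \<beta>) F" by (simp only: tendsto_norm_zero_iff Lim_null[of c])
  \<comment> \<open>The function \<open>\<beta> - b\<close> is split as
    \<open>(c r - b) - (c r - \<beta>)\<close>. The left side does not depend on \<open>r\<close>,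
    so the limit of the right side bounds it.\<close>
  have "(L2_norm {-1..0} (\<lambda>s. \<beta> - b s))\<^sup>2 \<le> 2 * (norm (c r - \<beta>))\<^sup>2 + 2 * (L2_norm {-1..0} (\<lambda>s. c r - b s))\<^sup>2" for r
    using L2_norm_sq_diff_le[OF cb L2_const, of r "c r - \<beta>"] by (simp add: L2_norm_const)
  moreover have "((\<lambda>r. 2 * (norm (c r - \<beta>))\<^sup>2 + 2 * (L2_norm {-1..0} (\<lambda>s. c r - b s))\<^sup>2) \<longlongrightarrow> 2 * 0\<^sup>2 + 2 * 0\<^sup>2) F"
    by (intro tendsto_intros lim \<open>((\<lambda>r. norm (c r - \<beta>)) \<longlongrightarrow> 0) F\<close>)
  ultimately have "(L2_norm {-1..0} (\<lambda>s. \<beta> - b s))\<^sup>2 \<le> 2 * 0\<^sup>2 + 2 * 0\<^sup>2"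
    using F by (intro tendsto_lowerbound[where F=F]) auto
  then have "L2_norm {-1..0} (\<lambda>s. \<beta> - b s) = 0" by simp
  then have "AE s in leb_I. \<beta> - b s = 0" by (intro L2_norm_zero_AE L2_diff L2_const b)
  then have "AE s in leb_I. b s = \<beta>" by (auto elim: eventually_mono)
  then show ?thesis using that c by blast
qed

section \<open>Difference quotients at times \<open>t \<ge> 0\<close>\<close>

lemma tendsto_zero_sq_le:
  fixes f g :: "'a \<Rightarrow> real"
  assumes "\<forall>\<^sub>F r in F. (f r)\<^sup>2 \<le> g r" "(g \<longlongrightarrow> 0) F"
  shows "(f \<longlongrightarrow> 0) F"
  by (rule tendsto_zero_if_sq, rule tendsto_sandwich[OF _ assms(1) tendsto_const assms(2)]) simp

text \<open>Brings the derivative of \<open>x\<close> into the form used by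
  \<open>frechet_deriv\<close>. Quotient and remainder form agree for \<open>r \<noteq> t\<close>,
  and the filter ignores \<open>r = t\<close>.\<close>

lemma has_vector_derivative_iff_quotient:
  "(f has_vector_derivative f') (at t within T) \<longleftrightarrow>
    ((\<lambda>r. norm ((f r - f t) /\<^sub>R (r - t) - f')) \<longlongrightarrow> 0) (at t within T)"
proof -
  have "norm ((f r - f t) /\<^sub>R (r - t) - f') = norm ((f r - f t) - (r - t) *\<^sub>R f') / norm (r - t)" if "r \<noteq> t" for r
  proof -
    have "(f r - f t) /\<^sub>R (r - t) - f' = ((f r - f t) - (r - t) *\<^sub>R f') /\<^sub>R (r - t)"
      using that by (simp add: scaleR_diff_right)
    then show ?thesis by (simp add: divide_inverse_commute)
  qed
  then have "((\<lambda>r. norm ((f r - f t) /\<^sub>R (r - t) - f')) \<longlongrightarrow> 0) (at t within T) \<longleftrightarrow>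
    ((\<lambda>r. norm ((f r - f t) - (r - t) *\<^sub>R f') / norm (r - t)) \<longlongrightarrow> 0) (at t within T)"
    by (intro filterlim_cong refl) (auto simp: eventually_at_filter)
  then show ?thesis
    by (simp add: has_vector_derivative_def has_derivative_iff_norm bounded_linear_scaleR_left)
qed

text \<open>Comparing constants through limits requires a proper filter, including the one-sided
  filter at \<open>t = 0\<close>.\<close>

lemma at_within_Ici_neq_bot:
  fixes t :: real
  assumes "t \<ge> 0"
  shows "at t within {0..} \<noteq> bot"
proof -
  have "t islimpt {t<..<t + 1}" by (intro islimpt_greaterThanLessThan1) simp
  then have "t islimpt {0..}" by (rule islimpt_subset) (use assms in auto)
  then show ?thesis by (simp add: trivial_limit_within)
qed

lemma eventually_at_within_Ici: "\<forall>\<^sub>F r in at t within {0..}. r \<ge> (0::real)"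
  by (simp add: eventually_at_filter)

lemma has_wderiv_quotient:
  assumes "has_wderiv {-1..0} f f'" "has_wderiv {-1..0} g g'" "has_wderiv {-1..0} d d'"
  shows "has_wderiv {-1..0} ((f - g) /\<^sub>R h - d) ((f' - g') /\<^sub>R h - d')"
  using has_wderiv_scaleR_diff[OF has_wderiv_scaleR_diff[OF assms(1,2), of 1] assms(3), of "inverse h"]
  by (simp add: scaleR_fun_def fun_diff_def)

lemma Z_space_iff: "X \<in> Z_space \<longleftrightarrow> snd X \<in> L2 {-1..0}"
  by (cases X) (simp add: Z_space_def)

lemma has_wderiv_add_const:
  assumes "has_wderiv {-1..0} f g"
  shows "has_wderiv {-1..0} (\<lambda>s. f s + c) g"
  unfolding has_wderiv_def
proof (intro conjI ballI impI has_wderiv_L2[OF assms])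
  fix s t :: real assume "s \<in> {-1..0}" "t \<in> {-1..0}" "s \<le> t"
  from has_wderivD[OF assms this]
  show "f t + c = f s + c + (LINT \<theta>|lebesgue_on {s..t}. g \<theta>)" by simp
qed

section \<open>The delay channel\<close>

lemma bounded_bilinear_matrix_vector_mult:
  "bounded_bilinear ((*v) :: real^'n^'m \<Rightarrow> real^'n \<Rightarrow> real^'m)"
  unfolding bilinear_conv_bounded_bilinear[symmetric] bilinear_def
  by (auto intro!: linearI simp: algebra_simps matrix_vector_mult_scaleR scaleR_matrix_vector_assoc)

lemma bounded_linear_matrix_vector_mult_left:
  "bounded_linear (\<lambda>A :: real^'n^'m. A *v x)"
  by (rule bounded_bilinear.bounded_linear_left[OF bounded_bilinear_matrix_vector_mult])

lemma bounded_linear_matrix_mult_right: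
  "bounded_linear ((**) (A :: real^'k^'m) :: real^'n^'k \<Rightarrow> real^'n^'m)"
  unfolding linear_conv_bounded_linear[symmetric]
  by (auto intro!: linearI sum.cong simp: matrix_add_ldistrib matrix_matrix_mult_def vec_eq_iff sum_distrib_left
      distrib_left sum.distrib)

lemma matrix_vector_mult_minus_left: "(- A) *v x = - (A *v x)" for A :: "real^'n^'m"
  using linear_neg[OF bounded_linear.linear[OF bounded_linear_matrix_vector_mult_left]] .

lemma norm_matrix_vector_mult_le:
  "\<exists>K\<ge>0. \<forall>(A :: real^'n^'m) x. norm (A *v x) \<le> norm A * norm x * K"
  using bounded_bilinear.nonneg_bounded[OF bounded_bilinear_matrix_vector_mult] by blast

lemma borel_measurable_matrix_vector_mult:
  fixes A :: "'a \<Rightarrow> real^'n^'m"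
  assumes "A \<in> borel_measurable M" "g \<in> borel_measurable M"
  shows "(\<lambda>s. A s *v g s) \<in> borel_measurable M"
  using assms
  by (rule borel_measurable_continuous_Pair)
     (intro bounded_bilinear.continuous_on[OF bounded_bilinear_matrix_vector_mult] continuous_intros)

lemma integrable_matrix_vector_mult:
  fixes A :: "real \<Rightarrow> real^'n^'m"
  assumes A: "A \<in> borel_measurable leb_I" "\<And>s. s \<in> {-1..0} \<Longrightarrow> norm (A s) \<le> C"
    and g: "integrable leb_I g"
  shows "integrable leb_I (\<lambda>s. A s *v g s)"
proof -
  obtain K where K: "K \<ge> 0" "\<And>(A :: real^'n^'m) x. norm (A *v x) \<le> norm A * norm x * K"
    using norm_matrix_vector_mult_le by blast
  have "integrable leb_I (\<lambda>s. C * K * norm (g s))" using g by auto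
  moreover have "AE s in leb_I. norm (A s *v g s) \<le> norm (C * K * norm (g s))"
  proof (rule AE_I2)
    fix s assume "s \<in> space leb_I"
    then have "norm (A s) \<le> C" using A(2) by simp
    then have "norm (A s) * norm (g s) * K \<le> C * norm (g s) * K"
      using K(1) by (intro mult_right_mono) auto
    then show "norm (A s *v g s) \<le> norm (C * K * norm (g s))"
      using K(2)[of "A s" "g s"] by (simp add: mult_ac)
  qed
  moreover have "(\<lambda>s. A s *v g s) \<in> borel_measurable leb_I"
    using A(1) g by (intro borel_measurable_matrix_vector_mult) auto
  ultimately show ?thesis
    by (blast intro: Bochner_Integration.integrable_bound)
qed

text \<open>Fubini on the triangle \<open>s \<le> \<theta>\<close>, whose sections are [s,0] for
  fixed \<open>s\<close> and [-1,theta] for fixed \<open>\<theta>\<close>. The values of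
  \<open>A\<close> accumulate into its primitive.\<close>

lemma integral_matrix_vector_mult_swap:
  fixes A :: "real \<Rightarrow> real^'n^'m"
  assumes A: "A \<in> borel_measurable leb_I" "\<And>s. s \<in> {-1..0} \<Longrightarrow> norm (A s) \<le> C"
    and g: "integrable leb_I g"
  shows "(LINT s|leb_I. A s *v (LINT \<theta>|lebesgue_on {s..0}. g \<theta>)) =
    (LINT \<theta>|leb_I. (LINT s|lebesgue_on {-1..\<theta>}. A s) *v g \<theta>)"
proof -
  interpret finite_measure leb_I by (rule finite_measure_leb_I)
  interpret P: pair_sigma_finite leb_I leb_I
    by (simp add: pair_sigma_finite_def sigma_finite_measure_axioms)
  have iA: "integrable leb_I A"
    by (rule integrable_const_bound[of _ C]) (use A in auto)
  \<comment> \<open>This makes the triangle a measurable set of the product space.\<close>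
  have id: "(\<lambda>s. s) \<in> borel_measurable leb_I"
    by (intro continuous_imp_measurable_on_sets_lebesgue continuous_intros) auto
  define H where "H = (\<lambda>s \<theta>. (if s \<le> \<theta> then A s *v g \<theta> else 0))"
  obtain K where K: "K \<ge> 0" "\<And>(A :: real^'n^'m) x. norm (A *v x) \<le> norm A * norm x * K"
    using norm_matrix_vector_mult_le by blast
  have gm: "g \<in> borel_measurable leb_I" using g by auto
  \<comment> \<open>A dominating function for \<open>H\<close>: it is constant in \<open>s\<close>,
    and the mass in that variable is finite.\<close>
  have ig: "integrable (leb_I \<Otimes>\<^sub>M leb_I) (\<lambda>(s, \<theta>). C * K * norm (g \<theta>))"
  proof (rule P.Fubini_integrable)
    show "(\<lambda>(s, \<theta>). C * K * norm (g \<theta>)) \<in> borel_measurable (leb_I \<Otimes>\<^sub>M leb_I)"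
      using gm by (simp add: case_prod_beta) 
  qed (use g in auto)
  have "integrable (leb_I \<Otimes>\<^sub>M leb_I) (\<lambda>(s, \<theta>). H s \<theta>)"
  proof (rule Bochner_Integration.integrable_bound[OF ig])
    have "(\<lambda>p. A (fst p)) \<in> borel_measurable (leb_I \<Otimes>\<^sub>M leb_I)"
      by (rule measurable_compose[OF measurable_fst A(1)])
    moreover have "(\<lambda>p. g (snd p)) \<in> borel_measurable (leb_I \<Otimes>\<^sub>M leb_I)"
      by (rule measurable_compose[OF measurable_snd gm])
    ultimately have m: "(\<lambda>p. A (fst p) *v g (snd p)) \<in> borel_measurable (leb_I \<Otimes>\<^sub>M leb_I)"
      by (rule borel_measurable_matrix_vector_mult)
    have [measurable]: "fst \<in> borel_measurable (leb_I \<Otimes>\<^sub>M leb_I)" "snd \<in> borel_measurable (leb_I \<Otimes>\<^sub>M leb_I)"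
      using measurable_compose[OF measurable_fst id] measurable_compose[OF measurable_snd id] by auto
    show "(\<lambda>(s, \<theta>). H s \<theta>) \<in> borel_measurable (leb_I \<Otimes>\<^sub>M leb_I)"
      unfolding H_def case_prod_beta by (intro measurable_If m) measurable
    show "AE p in leb_I \<Otimes>\<^sub>M leb_I. norm (case p of (s, \<theta>) \<Rightarrow> H s \<theta>) \<le> norm (case p of (s, \<theta>) \<Rightarrow> C * K * norm (g \<theta>))"
    proof (rule AE_I2)
      fix p assume "p \<in> space (leb_I \<Otimes>\<^sub>M leb_I)"
      then obtain s \<theta> where p: "p = (s, \<theta>)" "s \<in> {-1..0}" by (auto simp: space_pair_measure)
      have "norm (A s) * norm (g \<theta>) * K \<le> C * norm (g \<theta>) * K"
        using K(1) A(2)[OF p(2)] by (intro mult_right_mono) auto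
      then have "norm (A s *v g \<theta>) \<le> norm (C * K * norm (g \<theta>))"
        using K(2)[of "A s" "g \<theta>"] by (simp add: mult_ac)
      then show "norm (case p of (s, \<theta>) \<Rightarrow> H s \<theta>) \<le> norm (case p of (s, \<theta>) \<Rightarrow> C * K * norm (g \<theta>))"
        by (auto simp: p H_def)
    qed
  qed
  then have F: "(LINT \<theta>|leb_I. LINT s|leb_I. H s \<theta>) = (LINT s|leb_I. LINT \<theta>|leb_I. H s \<theta>)"
    by (rule P.Fubini_integral)
  have 1: "(LINT \<theta>|leb_I. H s \<theta>) = A s *v (LINT \<theta>|lebesgue_on {s..0}. g \<theta>)" if "s \<in> {-1..0}" for s
  proof -
    have "(LINT \<theta>|leb_I. H s \<theta>) = (LINT \<theta>|leb_I. (if \<theta> \<in> {s..0} then A s *v g \<theta> else 0))"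
      by (intro Bochner_Integration.integral_cong) (auto simp: H_def)
    also have "\<dots> = (LINT \<theta>|lebesgue_on {s..0}. A s *v g \<theta>)"
      using that by (intro Lebesgue_Measure.integral_restrict) auto
    also have "\<dots> = A s *v (LINT \<theta>|lebesgue_on {s..0}. g \<theta>)"
      using that by (intro integral_bounded_linear matrix_vector_mul_bounded_linear integrable_subinterval[OF g]) auto
    finally show ?thesis .
  qed
  have 2: "(LINT s|leb_I. H s \<theta>) = (LINT s|lebesgue_on {-1..\<theta>}. A s) *v g \<theta>" if "\<theta> \<in> {-1..0}" for \<theta>
  proof -
    have "(LINT s|leb_I. H s \<theta>) = (LINT s|leb_I. (if s \<in> {-1..\<theta>} then A s *v g \<theta> else 0))"
      by (intro Bochner_Integration.integral_cong) (auto simp: H_def)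
    also have "\<dots> = (LINT s|lebesgue_on {-1..\<theta>}. A s *v g \<theta>)"
      using that by (intro Lebesgue_Measure.integral_restrict) auto
    also have "\<dots> = (LINT s|lebesgue_on {-1..\<theta>}. A s) *v g \<theta>"
      using that by (intro integral_bounded_linear[OF bounded_linear_matrix_vector_mult_left] integrable_subinterval[OF iA]) auto
    finally show ?thesis .
  qed
  have "(LINT s|leb_I. A s *v (LINT \<theta>|lebesgue_on {s..0}. g \<theta>)) = (LINT s|leb_I. LINT \<theta>|leb_I. H s \<theta>)"
    by (intro Bochner_Integration.integral_cong refl) (simp add: 1)
  also have "\<dots> = (LINT \<theta>|leb_I. LINT s|leb_I. H s \<theta>)" by (rule F[symmetric])
  also have "\<dots> = (LINT \<theta>|leb_I. (LINT s|lebesgue_on {-1..\<theta>}. A s) *v g \<theta>)"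
    by (intro Bochner_Integration.integral_cong refl) (simp add: 2)
  finally show ?thesis .
qed

section \<open>The kernel of the delay channel and its primitive\<close>

locale delay_system =
  fixes S :: "('n::finite, 'm::finite, 'p::finite, 'q::finite, 'r::finite, 'v::finite, 'c::finite,
               'k::finite) sys"
  assumes tau_pos: "\<And>i. 0 < tau S i"
    and Cvd_measurable:
      "\<And>i. (\<lambda>\<theta>. cblock S i (Cvd S \<theta>)) \<in> borel_measurable (lebesgue_on {- tau S i..0})"
    and Cvd_bounded: "\<And>i. bounded ((\<lambda>\<theta>. cblock S i (Cvd S \<theta>)) ` {- tau S i..0})"
    and inv: "invertible (mat 1 - (\<Sum>i\<in>UNIV. Chat S i ** Drv S))"
begin

definition delay_kernel :: "real \<Rightarrow> real^'c^'v" where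
  "delay_kernel s = (\<Sum>i\<in>UNIV. tau S i *\<^sub>R cblock S i (Cvd S (tau S i * s)))"

text \<open>The function \<open>N\<close> of the overview.\<close>

definition kernel_primitive :: "real \<Rightarrow> real^'c^'v" where
  "kernel_primitive \<theta> = Cv S + (LINT s|lebesgue_on {-1..\<theta>}. delay_kernel s)"

lemma sum_cblock: "(\<Sum>i\<in>UNIV. cblock S i M) = M"
  by (simp add: cblock_def vec_eq_iff)

text \<open>Composition need not preserve Lebesgue measurability, but scaling by a nonzero number
  pulls Lebesgue sets back to Lebesgue sets; it maps [-1,0] into
  \<open>{- tau S i..0}\<close>.\<close>

lemma block_kernel_measurable: "(\<lambda>s. cblock S i (Cvd S (tau S i * s))) \<in> borel_measurable leb_I"
proof (rule measurable_compose[OF _ Cvd_measurable])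
  have "tau S i * s \<in> {- tau S i..0}" if "s \<in> {-1..0}" for s
    using that tau_pos[of i] mult_left_mono[of "-1" s "tau S i"] by (auto simp: mult_nonneg_nonpos)
  then show "(*) (tau S i) \<in> leb_I \<rightarrow>\<^sub>M lebesgue_on {- tau S i..0}"
    using lebesgue_measurable_scaling[of "tau S i", where 'a=real]
    by (intro measurable_restrict_space3) (auto simp: real_scaleR_def[abs_def])
qed

lemma block_kernel_bounded: "\<exists>C. \<forall>s\<in>{-1..0}. norm (cblock S i (Cvd S (tau S i * s))) \<le> C"
proof -
  have "tau S i * s \<in> {- tau S i..0}" if "s \<in> {-1..0}" for s
    using that tau_pos[of i] mult_left_mono[of "-1" s "tau S i"] by (auto simp: mult_nonneg_nonpos)
  then show ?thesis using Cvd_bounded[of i] unfolding bounded_iff by blast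
qed

lemma block_kernel_integrable: "integrable leb_I (\<lambda>s. cblock S i (Cvd S (tau S i * s)))"
proof -
  obtain C where "\<forall>s\<in>{-1..0}. norm (cblock S i (Cvd S (tau S i * s))) \<le> C"
    using block_kernel_bounded by blast
  then show ?thesis
    by (intro finite_measure.integrable_const_bound[OF finite_measure_leb_I, of _ C] block_kernel_measurable) auto
qed

lemma delay_kernel_measurable: "delay_kernel \<in> borel_measurable leb_I"
  unfolding delay_kernel_def[abs_def] using block_kernel_measurable by measurable

lemma delay_kernel_bounded: "\<exists>C. \<forall>s\<in>{-1..0}. norm (delay_kernel s) \<le> C"
proof -
  obtain C where C: "\<And>i s. s \<in> {-1..0} \<Longrightarrow> norm (cblock S i (Cvd S (tau S i * s))) \<le> C i"
    using block_kernel_bounded by metis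
  have "norm (delay_kernel s) \<le> (\<Sum>i\<in>UNIV. tau S i * C i)" if "s \<in> {-1..0}" for s
    unfolding delay_kernel_def[abs_def] using C[OF that] tau_pos
    by (intro sum_norm_le) (simp add: less_imp_le mult_left_mono)
  then show ?thesis by blast
qed

lemma delay_kernel_integrable: "integrable leb_I delay_kernel"
  unfolding delay_kernel_def[abs_def] by (intro Bochner_Integration.integrable_sum integrable_scaleR_right block_kernel_integrable)

lemma kernel_primitive_continuous: "continuous_on {-1..0} kernel_primitive"
  unfolding kernel_primitive_def
  by (intro continuous_intros indefinite_integral_continuous_real delay_kernel_integrable)

lemma kernel_primitive_measurable: "kernel_primitive \<in> borel_measurable leb_I"
  by (intro continuous_imp_measurable_on_sets_lebesgue kernel_primitive_continuous) auto

lemma kernel_primitive_bounded: "\<exists>C. \<forall>s\<in>{-1..0}. norm (kernel_primitive s) \<le> C"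
  using compact_imp_bounded[OF compact_continuous_image[OF kernel_primitive_continuous]]
  by (auto simp: bounded_iff)

lemma kernel_primitive_mult_integrable:
  "integrable leb_I g \<Longrightarrow> integrable leb_I (\<lambda>\<theta>. kernel_primitive \<theta> *v g \<theta>)"
  using kernel_primitive_bounded kernel_primitive_measurable integrable_matrix_vector_mult by blast

lemma sum_Chat: "(\<Sum>i\<in>UNIV. Chat S i) = kernel_primitive 0"
  unfolding Chat_def kernel_primitive_def delay_kernel_def[abs_def] sum.distrib sum_cblock
  by (subst Bochner_Integration.integral_sum) (auto intro: block_kernel_integrable)

lemma matrix_mult_sum_left: "(\<Sum>i\<in>A. F i ** N) = (\<Sum>i\<in>A. F i) ** (N :: real^'x^'y)"
  for F :: "'z \<Rightarrow> real^'y^'w"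
  by (induct A rule: infinite_finite_induct)
     (auto simp: matrix_matrix_mult_def vec_eq_iff sum.distrib distrib_right)

lemma CI_eq:
  assumes "\<theta> \<in> {-1..0}"
  shows "CI S \<theta> = - (DI S ** kernel_primitive \<theta>)"
proof -
  have i: "integrable (lebesgue_on {-1..\<theta>}) (\<lambda>s. cblock S i (Cvd S (tau S i * s)))" for i
    using assms by (intro integrable_subinterval[OF block_kernel_integrable]) auto
  have "kernel_primitive \<theta> = (\<Sum>i\<in>UNIV. cblock S i (Cv S) +
     tau S i *\<^sub>R (LINT \<eta>|lebesgue_on {-1..\<theta>}. cblock S i (Cvd S (tau S i * \<eta>))))"
    unfolding kernel_primitive_def delay_kernel_def[abs_def] sum.distrib sum_cblock
    by (subst Bochner_Integration.integral_sum) (auto intro: i)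
  then show ?thesis
    by (simp add: CI_def CIi_def sum_negf
        linear_sum[OF bounded_linear.linear[OF bounded_linear_matrix_mult_right]])
qed

lemma CI_mult_eq:
  assumes "\<theta> \<in> {-1..0}"
  shows "CI S \<theta> *v y = - (DI S *v (kernel_primitive \<theta> *v y))"
  using CI_eq[OF assms] by (simp add: matrix_vector_mul_assoc matrix_vector_mult_minus_left)

lemma CI_mult_integrable: 
  assumes "integrable leb_I g"
  shows "integrable leb_I (\<lambda>\<theta>. CI S \<theta> *v g \<theta>)"
proof -
  have "integrable leb_I (\<lambda>\<theta>. - (DI S *v (kernel_primitive \<theta> *v g \<theta>)))"
    by (intro Bochner_Integration.integrable_minus integrable_bounded_linear[OF matrix_vector_mul_bounded_linear]
        kernel_primitive_mult_integrable assms)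
  then show ?thesis
    by (rule Bochner_Integration.integrable_cong[THEN iffD1, rotated 2]) (auto simp: CI_mult_eq)
qed

definition CI_int :: "(real \<Rightarrow> real^'c) \<Rightarrow> real^'v" where
  "CI_int g = (LINT \<theta>|leb_I. CI S \<theta> *v g \<theta>)"

lemma CI_int_eq: 
  assumes "integrable leb_I g"
  shows "CI_int g = - (DI S *v (LINT \<theta>|leb_I. kernel_primitive \<theta> *v g \<theta>))"
proof -
  have "CI_int g = (LINT \<theta>|leb_I. - (DI S *v (kernel_primitive \<theta> *v g \<theta>)))"
    unfolding CI_int_def by (intro Bochner_Integration.integral_cong) (auto simp: CI_mult_eq)
  also have "\<dots> = - (DI S *v (LINT \<theta>|leb_I. kernel_primitive \<theta> *v g \<theta>))"
    by (simp add: integral_bounded_linear[OF matrix_vector_mul_bounded_linear kernel_primitive_mult_integrable[OF assms]])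
  finally show ?thesis .
qed

text \<open>The kernels \<open>bA\<close>, \<open>bC11\<close>, \<open>bC21\<close> and
  \<open>bTa\<close> all are a constant matrix times \<open>CI\<close>, so every integral term of
  the PIE factors through the single vector \<open>CI_int g\<close>.\<close>

lemma integral_matrix_CI:
  assumes "integrable leb_I g"
  shows "(LINT \<theta>|leb_I. (B ** CI S \<theta>) *v g \<theta>) = B *v CI_int g"
  unfolding CI_int_def matrix_vector_mul_assoc[symmetric]
  by (rule integral_bounded_linear[OF matrix_vector_mul_bounded_linear CI_mult_integrable[OF assms]])

lemma CI_int_scaleR_diff:
  assumes "integrable leb_I f" "integrable leb_I g"
  shows "CI_int (\<lambda>s. c *\<^sub>R f s - g s) = c *\<^sub>R CI_int f - CI_int g"
  using CI_mult_integrable[OF assms(1)] CI_mult_integrable[OF assms(2)]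
  by (simp add: CI_int_def matrix_vector_mult_diff_distrib matrix_vector_mult_scaleR)

lemma CI_int_cong_AE:
  assumes "integrable leb_I f" "integrable leb_I g" "AE s in leb_I. f s = g s"
  shows "CI_int f = CI_int g"
  unfolding CI_int_def
  using assms(3) borel_measurable_integrable[OF CI_mult_integrable[OF assms(1)]] borel_measurable_integrable[OF CI_mult_integrable[OF assms(2)]]
  by (intro integral_cong_AE) (auto elim: eventually_mono)

text \<open>The primitive of the kernel is continuous on a compact interval and hence bounded, and
  the L1 norm of \<open>g\<close> is at most its L2 norm.\<close>

lemma CI_int_bound: "\<exists>C\<ge>0. \<forall>g\<in>L2 {-1..0}. (norm (CI_int g))\<^sup>2 \<le> C * (L2_norm {-1..0} g)\<^sup>2"
proof -
  obtain N where N: "\<And>s. s \<in> {-1..0} \<Longrightarrow> norm (kernel_primitive s) \<le> N" using kernel_primitive_bounded by blast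
  obtain K where K: "K \<ge> 0" "\<And>(A :: real^'c^'v) x. norm (A *v x) \<le> norm A * norm x * K"
    using norm_matrix_vector_mult_le by blast
  obtain D where D: "D \<ge> 0" "\<And>x. norm (DI S *v x) \<le> norm x * D"
    using bounded_linear.nonneg_bounded[OF matrix_vector_mul_bounded_linear] by blast
  have "(norm (CI_int g))\<^sup>2 \<le> (N * K * D)\<^sup>2 * (L2_norm {-1..0} g)\<^sup>2" if g: "g \<in> L2 {-1..0}" for g
  proof -
    have i: "integrable leb_I g" using g by (rule L2_integrable)
    have "norm (LINT \<theta>|leb_I. kernel_primitive \<theta> *v g \<theta>) \<le> (LINT \<theta>|leb_I. norm (kernel_primitive \<theta> *v g \<theta>))"
      by (rule integral_norm_bound)
    also have "\<dots> \<le> (LINT \<theta>|leb_I. N * K * norm (g \<theta>))"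
    proof (intro integral_mono integrable_norm kernel_primitive_mult_integrable i)
      fix s assume "s \<in> space leb_I"
      then have "norm (kernel_primitive s) * norm (g s) * K \<le> N * norm (g s) * K"
        using K(1) N[of s] by (intro mult_right_mono) auto
      then show "norm (kernel_primitive s *v g s) \<le> N * K * norm (g s)"
        using K(2)[of "kernel_primitive s" "g s"] by (simp add: mult_ac)
    qed (use i in auto)
    finally have "norm (LINT \<theta>|leb_I. kernel_primitive \<theta> *v g \<theta>) \<le> N * K * (LINT \<theta>|leb_I. norm (g \<theta>))" by simp
    then have "norm (CI_int g) \<le> N * K * (LINT \<theta>|leb_I. norm (g \<theta>)) * D"
      unfolding CI_int_eq[OF i] norm_minus_cancel
      using D(2) mult_right_mono[OF _ D(1)] order_trans by blast
    then have "(norm (CI_int g))\<^sup>2 \<le> (N * K * (LINT \<theta>|leb_I. norm (g \<theta>)) * D)\<^sup>2"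
      by (simp add: power_mono)
    also have "\<dots> = (N * K * D)\<^sup>2 * (LINT \<theta>|leb_I. norm (g \<theta>))\<^sup>2" by (simp add: power_mult_distrib)
    also have "\<dots> \<le> (N * K * D)\<^sup>2 * (L2_norm {-1..0} g)\<^sup>2"
      using L1_sq_le_L2[OF g] by (intro mult_left_mono) auto
    finally show ?thesis .
  qed
  then show ?thesis by (intro exI[of _ "(N * K * D)\<^sup>2"]) auto
qed

section \<open>The linear equation for the delay output\<close>

lemma delay_out_eq_kernel:
  assumes "f \<in> L2 {-1..0}"
  shows "delay_out S f = Cv S *v f (-1) + (LINT s|leb_I. delay_kernel s *v f s)"
proof -
  have i: "integrable leb_I (\<lambda>s. cblock S i (Cvd S (tau S i * s)) *v f s)" for i
    using block_kernel_bounded[of i] block_kernel_measurable[of i] integrable_matrix_vector_mult L2_integrable[OF assms] by blast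
  have lin: "(\<Sum>i\<in>UNIV. F i *v y) = (\<Sum>i\<in>UNIV. F i) *v y" for F :: "'k \<Rightarrow> real^'c^'v" and y
    by (rule linear_sum[OF bounded_linear.linear[OF bounded_linear_matrix_vector_mult_left], symmetric])
  have "(LINT s|leb_I. delay_kernel s *v f s) =
    (LINT s|leb_I. (\<Sum>i\<in>UNIV. (tau S i *\<^sub>R cblock S i (Cvd S (tau S i * s))) *v f s))"
    by (simp add: delay_kernel_def[abs_def] lin)
  also have "\<dots> = (\<Sum>i\<in>UNIV. LINT s|leb_I. (tau S i *\<^sub>R cblock S i (Cvd S (tau S i * s))) *v f s)"
    by (intro Bochner_Integration.integral_sum) (simp add: scaleR_matrix_vector_assoc[symmetric] i)
  finally show ?thesis
    by (simp add: delay_out_def lin sum_cblock)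
qed

text \<open>Integration by parts, carried out through Fubini. The boundary term at -1 carries the
  factor \<open>Cv S\<close> and cancels the point evaluation in \<open>delay_out\<close>; only the
  one at 0 remains.\<close>

lemma delay_out_eq_wderiv:
  assumes f: "has_wderiv {-1..0} f g"
  shows "delay_out S f = kernel_primitive 0 *v f 0 - (LINT \<theta>|leb_I. kernel_primitive \<theta> *v g \<theta>)"
proof -
  have g: "integrable leb_I g" using f by (simp add: L2_integrable has_wderiv_L2)
  obtain C where C: "\<And>s. s \<in> {-1..0} \<Longrightarrow> norm (delay_kernel s) \<le> C" using delay_kernel_bounded by blast
  have fs: "f s = f 0 - (LINT \<theta>|lebesgue_on {s..0}. g \<theta>)" if "s \<in> {-1..0}" for s
    using f that unfolding has_wderiv_interval_iff by blast
  have i1: "integrable leb_I (\<lambda>s. delay_kernel s *v f s)" "integrable leb_I (\<lambda>s. delay_kernel s *v f 0)"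
    by (intro integrable_matrix_vector_mult[where C=C] delay_kernel_measurable C
        L2_integrable[OF has_wderiv_imp_L2[OF f]] integrable_leb_I_const; assumption)+
  have "(LINT s|leb_I. delay_kernel s *v (LINT \<theta>|lebesgue_on {s..0}. g \<theta>)) = (LINT s|leb_I. delay_kernel s *v f 0 - delay_kernel s *v f s)"
  proof (intro Bochner_Integration.integral_cong refl)
    fix s assume "s \<in> space leb_I"
    then have "(LINT \<theta>|lebesgue_on {s..0}. g \<theta>) = f 0 - f s" using fs[of s] by simp
    then show "delay_kernel s *v (LINT \<theta>|lebesgue_on {s..0}. g \<theta>) = delay_kernel s *v f 0 - delay_kernel s *v f s"
      by (simp only: matrix_vector_mult_diff_distrib)
  qed
  also have "\<dots> = (LINT s|leb_I. delay_kernel s *v f 0) - (LINT s|leb_I. delay_kernel s *v f s)" using i1 by simp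
  also have "(LINT s|leb_I. delay_kernel s *v f 0) = (LINT s|leb_I. delay_kernel s) *v f 0"
    by (rule integral_bounded_linear[OF bounded_linear_matrix_vector_mult_left delay_kernel_integrable])
  finally have 1: "(LINT s|leb_I. delay_kernel s *v f s) = (LINT s|leb_I. delay_kernel s) *v f 0 - (LINT s|leb_I. delay_kernel s *v (LINT \<theta>|lebesgue_on {s..0}. g \<theta>))"
    by simp
  have i2: "integrable leb_I (\<lambda>\<theta>. Cv S *v g \<theta>)"
    by (rule integrable_bounded_linear[OF matrix_vector_mul_bounded_linear g])
  \<comment> \<open>The swap produces the primitive that vanishes at -1, which is
    \<open>kernel_primitive\<close> minus \<open>Cv S\<close>.\<close>
  have "(LINT \<theta>|leb_I. (LINT s|lebesgue_on {-1..\<theta>}. delay_kernel s) *v g \<theta>) = (LINT \<theta>|leb_I. kernel_primitive \<theta> *v g \<theta> - Cv S *v g \<theta>)"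
    by (simp add: kernel_primitive_def algebra_simps)
  also have "\<dots> = (LINT \<theta>|leb_I. kernel_primitive \<theta> *v g \<theta>) - Cv S *v (LINT \<theta>|leb_I. g \<theta>)"
    using kernel_primitive_mult_integrable[OF g] i2
    by (simp add: integral_bounded_linear[OF matrix_vector_mul_bounded_linear g])
  finally have 2: "(LINT s|leb_I. delay_kernel s *v (LINT \<theta>|lebesgue_on {s..0}. g \<theta>)) =
     (LINT \<theta>|leb_I. kernel_primitive \<theta> *v g \<theta>) - Cv S *v (LINT \<theta>|leb_I. g \<theta>)"
    using integral_matrix_vector_mult_swap[OF delay_kernel_measurable C g] by simp
  have "f (-1) = f 0 - (LINT \<theta>|leb_I. g \<theta>)" by (rule fs) simp
  then have "Cv S *v f (-1) = Cv S *v f 0 - Cv S *v (LINT \<theta>|leb_I. g \<theta>)"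
    by (simp only: matrix_vector_mult_diff_distrib)
  then show ?thesis
    unfolding delay_out_eq_kernel[OF has_wderiv_imp_L2[OF f]] 1 2
    by (simp add: kernel_primitive_def algebra_simps)
qed

text \<open>\<open>matrix_inv\<close> chooses a two-sided inverse. The first equation makes the
  solution of the linear equation unique, the second makes it exist.\<close>

lemma DI_inverse:
  "DI S ** (mat 1 - kernel_primitive 0 ** Drv S) = mat 1"
  "(mat 1 - kernel_primitive 0 ** Drv S) ** DI S = mat 1"
  using someI_ex[OF inv[unfolded invertible_def]]
  by (auto simp: DI_def matrix_inv_def matrix_mult_sum_left sum_Chat)

definition vout :: "real^'n \<Rightarrow> real^'m \<Rightarrow> real^'p \<Rightarrow> (real \<Rightarrow> real^'c) \<Rightarrow> real^'v" where
  "vout x \<omega> \<mu> g = Cvx S *v x + Dvw S *v \<omega> + Dvu S *v \<mu> + CI_int g"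

lemma vout_eq:
  assumes "integrable leb_I g"
  shows "vout x \<omega> \<mu> g = DI S *v (kernel_primitive 0 *v (Cr S *v x + Br1 S *v \<omega> + Br2 S *v \<mu>)
    - (LINT \<theta>|leb_I. kernel_primitive \<theta> *v g \<theta>))"
  unfolding vout_def CI_int_eq[OF assms] Cvx_def Dvw_def Dvu_def matrix_mult_sum_left sum_Chat
  by (simp add: matrix_vector_mul_assoc algebra_simps)

text \<open>Both directions are used: from left to right to identify the \<open>v\<close> of a given
  ODE-PDE solution, from right to left to verify that a function built from a PIE solution has the
  expected output.\<close>

lemma vout_unique:
  assumes f: "has_wderiv {-1..0} f g"
    and f0: "f 0 = Cr S *v x + Br1 S *v \<omega> + Br2 S *v \<mu> + Drv S *v v"
  shows "delay_out S f = v \<longleftrightarrow> v = vout x \<omega> \<mu> g"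
proof -
  let ?q = "Cr S *v x + Br1 S *v \<omega> + Br2 S *v \<mu>" and ?n = "LINT \<theta>|leb_I. kernel_primitive \<theta> *v g \<theta>"
  let ?E = "mat 1 - kernel_primitive 0 ** Drv S"
  have i: "integrable leb_I g" using f by (simp add: L2_integrable has_wderiv_L2)
  have d: "delay_out S f = kernel_primitive 0 *v ?q + kernel_primitive 0 *v (Drv S *v v) - ?n"
    unfolding delay_out_eq_wderiv[OF f] f0 by (simp add: algebra_simps)
  have E: "?E *v v = v - kernel_primitive 0 *v (Drv S *v v)"
    by (simp add: matrix_vector_mult_diff_rdistrib matrix_vector_mul_assoc)
  have "a + b - c = v \<longleftrightarrow> v - b = a - c" for a b c :: "real^'v"
    by (auto simp: algebra_simps)
  then have "delay_out S f = v \<longleftrightarrow> ?E *v v = kernel_primitive 0 *v ?q - ?n"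
    unfolding d E by blast
  also have "\<dots> \<longleftrightarrow> v = DI S *v (kernel_primitive 0 *v ?q - ?n)"
  proof
    assume *: "?E *v v = kernel_primitive 0 *v ?q - ?n"
    have "v = DI S *v (?E *v v)" by (simp only: matrix_vector_mul_assoc DI_inverse matrix_vector_mul_lid)
    then show "v = DI S *v (kernel_primitive 0 *v ?q - ?n)" by (simp only: *)
  qed (simp only: matrix_vector_mul_assoc DI_inverse matrix_vector_mul_lid)
  also have "\<dots> \<longleftrightarrow> v = vout x \<omega> \<mu> g" by (simp only: vout_eq[OF i])
  finally show ?thesis .
qed

section \<open>The operator \<open>T\<close> and the equivalence\<close>

text \<open>The value at \<open>s = 0\<close> of the function component of \<open>opT S X\<close>,
  see \<open>snd_opT_0\<close>.\<close>

definition T_end :: "(real^'n) \<times> (real \<Rightarrow> real^'c) \<Rightarrow> real^'c" where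
  "T_end X = bT0 S *v fst X + Drv S *v CI_int (snd X)"

definition BT :: "real^'m \<Rightarrow> real^'p \<Rightarrow> real^'c" where
  "BT \<omega> \<mu> = bT1 S *v \<omega> + bT2 S *v \<mu>"

text \<open>The integrals of \<open>bTa\<close> over \<open>[-1,s]\<close> and \<open>[s,0]\<close> add up to one that does not depend on \<open>s\<close>.\<close>

lemma snd_opT:
  assumes X: "X \<in> Z_space" and s: "s \<in> {-1..0}"
  shows "snd (opT S X) s = T_end X - (LINT \<theta>|lebesgue_on {s..0}. snd X \<theta>)"
proof -
  have i: "integrable leb_I (snd X)" using X by (simp add: Z_space_iff L2_integrable)
  let ?h = "\<lambda>\<theta>. (Drv S ** CI S \<theta>) *v snd X \<theta>"
  have ih: "integrable leb_I ?h"
    unfolding matrix_vector_mul_assoc[symmetric]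
    by (rule integrable_bounded_linear[OF matrix_vector_mul_bounded_linear CI_mult_integrable[OF i]])
  have int_s: "integrable (lebesgue_on {s..0}) (snd X)" "integrable (lebesgue_on {s..0}) ?h"
    using s by (auto intro: integrable_subinterval[OF i] integrable_subinterval[OF ih])
  have "(LINT \<theta>|lebesgue_on {s..0}. bTb S s \<theta> *v snd X \<theta>) = (LINT \<theta>|lebesgue_on {s..0}. ?h \<theta> - snd X \<theta>)"
    by (simp add: bTb_def bTa_def matrix_vector_mult_diff_rdistrib)
  also have "\<dots> = (LINT \<theta>|lebesgue_on {s..0}. ?h \<theta>) - (LINT \<theta>|lebesgue_on {s..0}. snd X \<theta>)"
    using int_s by simp
  finally have 1: "(LINT \<theta>|lebesgue_on {s..0}. bTb S s \<theta> *v snd X \<theta>) = \<dots>" .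
  have 2: "(LINT \<theta>|leb_I. ?h \<theta>) = (LINT \<theta>|lebesgue_on {-1..s}. ?h \<theta>) + (LINT \<theta>|lebesgue_on {s..0}. ?h \<theta>)"
    using s by (intro Equivalence_Measurable_On_Borel.integral_combine ih) auto
  have 3: "(LINT \<theta>|leb_I. ?h \<theta>) = Drv S *v CI_int (snd X)"
    by (rule integral_matrix_CI[OF i])
  show ?thesis
    unfolding opT_def T_end_def snd_conv 1 3[symmetric] 2 by (simp add: bTa_def)
qed

lemma snd_opT_0:
  assumes "X \<in> Z_space"
  shows "snd (opT S X) 0 = T_end X"
proof -
  have i: "integrable leb_I (snd X)" using assms by (simp add: Z_space_iff L2_integrable)
  have "integrable (lebesgue_on {0..0}) (snd X)" by (rule integrable_subinterval[OF i]) simp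
  then have "(LINT \<theta>|lebesgue_on {0..0::real}. snd X \<theta>) = 0"
    by (subst lebesgue_integral_eq_integral) auto
  then show ?thesis using snd_opT[OF assms, of 0] by simp
qed

text \<open>The state enters \<open>snd_opT\<close> only through a constant and an integral from
  \<open>s\<close> to 0. Thus T undoes weak differentiation, the link between the states of the two
  systems.\<close>

lemma opT_has_wderiv:
  assumes "X \<in> Z_space"
  shows "has_wderiv {-1..0} (snd (opT S X)) (snd X)"
  unfolding has_wderiv_interval_iff
  using assms by (auto simp: snd_opT_0[OF assms] snd_opT[OF assms] Z_space_iff)

text \<open>Equality almost everywhere becomes equality at every point, since both functions share a
  weak derivative and an end value.\<close>

lemma opT_cong_AE:
  assumes "X \<in> Z_space" "Y \<in> Z_space" "Z_eq X Y" "s \<in> {-1..0}"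
  shows "snd (opT S X) s = snd (opT S Y) s"
proof -
  have e: "fst X = fst Y" "AE s in leb_I. snd X s = snd Y s" using assms(3) by (auto simp: Z_eq_def)
  have L: "snd X \<in> L2 {-1..0}" "snd Y \<in> L2 {-1..0}" using assms by (auto simp: Z_space_iff)
  have "has_wderiv {-1..0} (snd (opT S X)) (snd Y)"
    by (rule has_wderiv_cong_AE[OF opT_has_wderiv[OF assms(1)] L(2) e(2)])
  then have "snd (opT S X) s = T_end X - (LINT \<theta>|lebesgue_on {s..0}. snd Y \<theta>)"
    using assms(4) snd_opT_0[OF assms(1)] unfolding has_wderiv_interval_iff by simp
  moreover have "T_end X = T_end Y"
    unfolding T_end_def using e CI_int_cong_AE[OF L2_integrable[OF L(1)] L2_integrable[OF L(2)]] by simp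
  ultimately show ?thesis using snd_opT[OF assms(2,4)] by simp
qed

section \<open>Linearity and boundedness of T\<close>

lemma Z_space_scaleR_diff: "X \<in> Z_space \<Longrightarrow> Y \<in> Z_space \<Longrightarrow> c *\<^sub>R X - Y \<in> Z_space"
  for X Y :: "'a::euclidean_space \<times> (real \<Rightarrow> 'b::euclidean_space)"
  using L2_diff[OF L2_scaleR, of "snd X" _ "snd Y" c]
  by (simp add: Z_space_iff scaleR_fun_def fun_diff_def)

lemma T_end_scaleR_diff:
  assumes "X \<in> Z_space" "Y \<in> Z_space"
  shows "T_end (c *\<^sub>R X - Y) = c *\<^sub>R T_end X - T_end Y"
proof -
  have i: "integrable leb_I (snd X)" "integrable leb_I (snd Y)" using assms by (auto simp: Z_space_iff L2_integrable)
  have "snd (c *\<^sub>R X - Y) = (\<lambda>s. c *\<^sub>R snd X s - snd Y s)"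
    by (simp add: scaleR_fun_def fun_diff_def)
  then show ?thesis
    unfolding T_end_def
    by (simp add: CI_int_scaleR_diff[OF i] algebra_simps)
qed

lemma Z_space_quotient:
  fixes X Y D :: "'a::euclidean_space \<times> (real \<Rightarrow> 'b::euclidean_space)"
  assumes "X \<in> Z_space" "Y \<in> Z_space" "D \<in> Z_space"
  shows "(X - Y) /\<^sub>R h - D \<in> Z_space"
  using Z_space_scaleR_diff[OF Z_space_scaleR_diff[OF assms(1,2), of 1] assms(3), of "inverse h"] by simp

lemma T_end_quotient:
  assumes "X \<in> Z_space" "Y \<in> Z_space" "D \<in> Z_space"
  shows "T_end ((X - Y) /\<^sub>R h - D) = (T_end X - T_end Y) /\<^sub>R h - T_end D"
  using T_end_scaleR_diff[OF Z_space_scaleR_diff[OF assms(1,2), of 1] assms(3), of "inverse h"]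
    T_end_scaleR_diff[OF assms(1,2), of 1] by simp

text \<open>Both sides have the weak derivative \<open>snd ((X - Y) /\<^sub>R h - D)\<close> and the
  same value at 0.\<close>

lemma opT_quotient:
  assumes X: "X \<in> Z_space" "Y \<in> Z_space" "D \<in> Z_space" and s: "s \<in> {-1..0}"
  shows "snd (opT S ((X - Y) /\<^sub>R h - D)) s =
    (snd (opT S X) s - snd (opT S Y) s) /\<^sub>R h - snd (opT S D) s"
proof -
  let ?Q = "(X - Y) /\<^sub>R h - D" and ?f = "(snd (opT S X) - snd (opT S Y)) /\<^sub>R h - snd (opT S D)"
  have Q: "?Q \<in> Z_space" by (intro Z_space_quotient X)
  have "has_wderiv {-1..0} ?f (snd ?Q)"
    using has_wderiv_quotient[OF opT_has_wderiv[OF X(1)] opT_has_wderiv[OF X(2)] opT_has_wderiv[OF X(3)]] by simp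
  then have "?f s = ?f 0 - (LINT \<theta>|lebesgue_on {s..0}. snd ?Q \<theta>)"
    using s unfolding has_wderiv_interval_iff by blast
  also have "?f 0 = T_end ?Q"
    unfolding T_end_quotient[OF X] by (simp add: scaleR_fun_def snd_opT_0[OF X(1)] snd_opT_0[OF X(2)] snd_opT_0[OF X(3)])
  also have "T_end ?Q - (LINT \<theta>|lebesgue_on {s..0}. snd ?Q \<theta>) = snd (opT S ?Q) s"
    by (rule snd_opT[OF Q s, symmetric])
  finally show ?thesis by (simp add: scaleR_fun_def)
qed

lemma opT_bound:
  obtains C where "C \<ge> 0"
    "\<And>X. X \<in> Z_space \<Longrightarrow> (norm (T_end X))\<^sup>2 \<le> C * (Z_norm X)\<^sup>2"
    "\<And>X. X \<in> Z_space \<Longrightarrow> (L2_norm {-1..0} (snd (opT S X)))\<^sup>2 \<le> C * (Z_norm X)\<^sup>2"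
proof -
  obtain A where A: "\<And>x. norm (bT0 S *v x) \<le> norm x * A"
    using bounded_linear.nonneg_bounded[OF matrix_vector_mul_bounded_linear] by blast
  obtain B where B: "\<And>x. norm (Drv S *v x) \<le> norm x * B"
    using bounded_linear.nonneg_bounded[OF matrix_vector_mul_bounded_linear] by blast
  obtain C where C: "C \<ge> 0" "\<And>g. g \<in> L2 {-1..0} \<Longrightarrow> (norm (CI_int g))\<^sup>2 \<le> C * (L2_norm {-1..0} g)\<^sup>2"
    using CI_int_bound by blast
  \<comment> \<open>Bounds for the two summands of \<open>T_end\<close>, each doubled by
    \<open>norm_sq_add_le\<close>.\<close>
  let ?K = "2 * A\<^sup>2 + 2 * (B\<^sup>2 * C)"
  have K: "?K \<ge> 0" using C(1) by simp
  have T: "(norm (T_end X))\<^sup>2 \<le> ?K * (Z_norm X)\<^sup>2" if X: "X \<in> Z_space" for X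
  proof -
    have le: "(norm (fst X))\<^sup>2 \<le> (Z_norm X)\<^sup>2" "(L2_norm {-1..0} (snd X))\<^sup>2 \<le> (Z_norm X)\<^sup>2"
      by (auto simp: Z_norm_sq)
    have "(norm (bT0 S *v fst X))\<^sup>2 \<le> (norm (fst X) * A)\<^sup>2" using A by (simp add: power_mono)
    also have "\<dots> \<le> A\<^sup>2 * (Z_norm X)\<^sup>2"
      using le(1) by (simp add: power_mult_distrib mult.commute mult_left_mono)
    finally have 1: "(norm (bT0 S *v fst X))\<^sup>2 \<le> A\<^sup>2 * (Z_norm X)\<^sup>2" .
    have "(norm (Drv S *v CI_int (snd X)))\<^sup>2 \<le> (norm (CI_int (snd X)) * B)\<^sup>2" using B by (simp add: power_mono)
    also have "\<dots> = B\<^sup>2 * (norm (CI_int (snd X)))\<^sup>2" by (simp add: power_mult_distrib)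
    also have "\<dots> \<le> B\<^sup>2 * (C * (L2_norm {-1..0} (snd X))\<^sup>2)"
      using C(2)[of "snd X"] X by (intro mult_left_mono) (auto simp: Z_space_iff)
    also have "\<dots> \<le> B\<^sup>2 * (C * (Z_norm X)\<^sup>2)"
      using le(2) C(1) by (intro mult_left_mono) auto
    finally have 2: "(norm (Drv S *v CI_int (snd X)))\<^sup>2 \<le> B\<^sup>2 * (C * (Z_norm X)\<^sup>2)" .
    show ?thesis
      unfolding T_end_def
      using norm_sq_add_le[of "bT0 S *v fst X" "Drv S *v CI_int (snd X)"] 1 2
      by (simp add: algebra_simps)
  qed
  \<comment> \<open>By \<open>L2_norm_sq_le_wderiv\<close>, twice the bound for the end value plus
    twice the squared norm of the derivative.\<close>
  have "(L2_norm {-1..0} (snd (opT S X)))\<^sup>2 \<le> (2 * ?K + 2) * (Z_norm X)\<^sup>2" if X: "X \<in> Z_space" for X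
  proof -
    have "(L2_norm {-1..0} (snd (opT S X)))\<^sup>2 \<le> 2 * (norm (T_end X))\<^sup>2 + 2 * (L2_norm {-1..0} (snd X))\<^sup>2"
      using L2_norm_sq_le_wderiv[OF opT_has_wderiv[OF X]] by (simp add: snd_opT_0[OF X])
    also have "\<dots> \<le> 2 * (?K * (Z_norm X)\<^sup>2) + 2 * (Z_norm X)\<^sup>2"
      using T[OF X] by (intro add_mono mult_left_mono) (auto simp: Z_norm_sq)
    finally show ?thesis by (simp add: algebra_simps)
  qed
  moreover have "(norm (T_end X))\<^sup>2 \<le> (2 * ?K + 2) * (Z_norm X)\<^sup>2" if X: "X \<in> Z_space" for X
  proof -
    have "k \<ge> 0 \<Longrightarrow> k \<le> 2 * k + 2" for k :: real by linarith
    from this[OF K] have "?K \<le> 2 * ?K + 2" .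
    then show ?thesis by (rule order_trans[OF T[OF X] mult_right_mono]) simp
  qed
  ultimately show ?thesis using that[of "2 * ?K + 2"] K by simp
qed

section \<open>Boundary condition and state equations expressed through \<open>vout\<close>\<close>

lemma T_end_BT: "T_end (x, g) + BT \<omega> \<mu> = Cr S *v x + Br1 S *v \<omega> + Br2 S *v \<mu> + Drv S *v vout x \<omega> \<mu> g"
  by (simp add: T_end_def BT_def vout_def bT0_def bT1_def bT2_def matrix_vector_mul_assoc algebra_simps)

text \<open>Once \<open>v\<close> is known to be \<open>vout\<close>, the boundary condition gives
  \<open>f\<close> the end value of \<open>opT\<close> shifted by \<open>BT\<close>, and the
  derivative \<open>g\<close> fixes the rest.\<close>

lemma boundary_imp_opT:
  assumes f: "has_wderiv {-1..0} f g"
    and f0: "f 0 = Cr S *v x + Br1 S *v \<omega> + Br2 S *v \<mu> + Drv S *v v"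
    and v: "v = delay_out S f"
  shows "v = vout x \<omega> \<mu> g"
    and "s \<in> {-1..0} \<Longrightarrow> f s = snd (opT S (x, g)) s + BT \<omega> \<mu>"
proof -
  show v': "v = vout x \<omega> \<mu> g" using vout_unique[OF f f0] v by simp
  have Z: "(x, g) \<in> Z_space" using f by (simp add: Z_space_iff has_wderiv_L2)
  assume s: "s \<in> {-1..0}"
  have "f s = f 0 - (LINT \<theta>|lebesgue_on {s..0}. g \<theta>)"
    using f s unfolding has_wderiv_interval_iff by blast
  also have "f 0 = T_end (x, g) + BT \<omega> \<mu>" unfolding f0 v' T_end_BT ..
  finally show "f s = snd (opT S (x, g)) s + BT \<omega> \<mu>" by (simp add: snd_opT[OF Z s])
qed

text \<open>Used at each time for the solution, and with zero inputs for the initial function, where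
  the boundary condition becomes the sewing condition.\<close>

lemma opT_imp_boundary:
  assumes X: "X \<in> Z_space"
    and f_def: "f = (\<lambda>s. snd (opT S X) s + BT \<omega> \<mu>)"
  shows "has_wderiv {-1..0} f (snd X)"
    and "delay_out S f = vout (fst X) \<omega> \<mu> (snd X)"
    and "f 0 = Cr S *v fst X + Br1 S *v \<omega> + Br2 S *v \<mu> + Drv S *v delay_out S f"
proof -
  show w: "has_wderiv {-1..0} f (snd X)"
    unfolding f_def by (intro has_wderiv_add_const opT_has_wderiv X)
  have f0: "f 0 = Cr S *v fst X + Br1 S *v \<omega> + Br2 S *v \<mu> + Drv S *v vout (fst X) \<omega> \<mu> (snd X)"
    unfolding T_end_BT[symmetric] f_def by (simp add: snd_opT_0[OF X])
  show v: "delay_out S f = vout (fst X) \<omega> \<mu> (snd X)" using vout_unique[OF w f0] by simp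
  show "f 0 = Cr S *v fst X + Br1 S *v \<omega> + Br2 S *v \<mu> + Drv S *v delay_out S f"
    using f0 v by simp
qed

text \<open>Each boldface matrix is the original one plus \<open>Bv S\<close> times the matching
  part of \<open>vout\<close>; the integral supplies the \<open>CI_int\<close> part. The two output
  equations below follow the same pattern.\<close>

lemma fst_opA:
  assumes "(x, g) \<in> Z_space"
  shows "fst (opA S (x, g) + opB1 S \<omega> + opB2 S \<mu>) =
    A0 S *v x + B1 S *v \<omega> + B2 S *v \<mu> + Bv S *v vout x \<omega> \<mu> g"
  using integral_matrix_CI[of g "Bv S"] assms
  by (simp add: Z_space_iff L2_integrable opA_def opB1_def opB2_def bA_def bA0_def bB1_def bB2_def vout_def matrix_vector_mul_assoc algebra_simps)

lemma opC1_eq: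
  assumes "(x, g) \<in> Z_space"
  shows "opC1 S (x, g) + bD11 S *v \<omega> + bD12 S *v \<mu> =
    C1 S *v x + D11 S *v \<omega> + D12 S *v \<mu> + D1v S *v vout x \<omega> \<mu> g"
  using integral_matrix_CI[of g "D1v S"] assms
  by (simp add: Z_space_iff L2_integrable opC1_def bC11_def bC10_def bD11_def bD12_def vout_def matrix_vector_mul_assoc algebra_simps)

lemma opC2_eq:
  assumes "(x, g) \<in> Z_space"
  shows "opC2 S (x, g) + bD21 S *v \<omega> + bD22 S *v \<mu> =
    C2 S *v x + D21 S *v \<omega> + D22 S *v \<mu> + D2v S *v vout x \<omega> \<mu> g"
  using integral_matrix_CI[of g "D2v S"] assms
  by (simp add: Z_space_iff L2_integrable opC2_def bC21_def bC20_def bD21_def bD22_def vout_def matrix_vector_mul_assoc algebra_simps)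

lemma Itau_mult_nth: "(Itau S *v y) $ c = (1 / tau S (blk S c)) * y $ c"
proof -
  have "(Itau S *v y) $ c = (\<Sum>d\<in>UNIV. if c = d then 1 / tau S (blk S c) * y $ d else 0)"
    unfolding Itau_def matrix_vector_mult_def by (simp only: vec_lambda_beta) (rule sum.cong; simp)
  then show ?thesis by simp
qed

lemma opBT_eq: "opBT1 S \<omega> + opBT2 S \<mu> = (0, \<lambda>s. BT \<omega> \<mu>)"
  by (simp add: opBT1_def opBT2_def BT_def fun_eq_iff)

lemma snd_opA: "snd (opA S X + opB1 S \<omega> + opB2 S \<mu>) s = Itau S *v snd X s"
  by (simp add: opA_def opB1_def opB2_def)

section \<open>From the ODE-PDE to the PIE\<close>

lemma ODE_PDE_imp_PIE:
  assumes ode: "satisfies_ODE_PDE S u w x0 \<phi>0 x \<phi> v y z"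
  shows "satisfies_PIE S u w (x0, wderiv {-1..0} \<phi>0) (\<lambda>t. (x t, wderiv {-1..0} (\<phi> t))) y z"
proof -
  let ?D = "\<lambda>f. wderiv {-1..0} f"
  define X where "X = (\<lambda>t. (x t, ?D (\<phi> t)))"
  have W0: "\<phi>0 \<in> W12 {-1..0}" and x0: "x 0 = x0" and \<phi>0: "\<And>s. s \<in> {-1..0} \<Longrightarrow> \<phi> 0 s = \<phi>0 s"
    and dx: "\<And>t. t \<ge> 0 \<Longrightarrow> (x has_vector_derivative
        (A0 S *v x t + B1 S *v w t + B2 S *v u t + Bv S *v v t)) (at t within {0..})"
    and zt: "\<And>t. t \<ge> 0 \<Longrightarrow> z t = C1 S *v x t + D11 S *v w t + D12 S *v u t + D1v S *v v t"
    and yt: "\<And>t. t \<ge> 0 \<Longrightarrow> y t = C2 S *v x t + D21 S *v w t + D22 S *v u t + D2v S *v v t"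
    and bc: "\<And>t. t \<ge> 0 \<Longrightarrow> \<phi> t 0 = Cr S *v x t + Br1 S *v w t + Br2 S *v u t + Drv S *v v t"
    and d\<phi>: "\<And>t. t \<ge> 0 \<Longrightarrow> \<exists>d. frechet_deriv (W12 {-1..0}) (W12_norm {-1..0}) \<phi> d t \<and>
        (AE s in leb_I. \<forall>i c. blk S c = i \<longrightarrow> d s $ c = (1 / tau S i) * ?D (\<phi> t) s $ c)"
    and vt: "\<And>t. t \<ge> 0 \<Longrightarrow> v t = delay_out S (\<phi> t)"
    using ode unfolding satisfies_ODE_PDE_def by auto
  \<comment> \<open>Differentiability at a single time already includes membership in
    \<open>W12\<close> at all times.\<close>
  have "\<And>r. r \<ge> 0 \<Longrightarrow> \<phi> r \<in> W12 {-1..0}" using d\<phi>[of 0] unfolding frechet_deriv_def by blast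
  then have wd: "\<And>r. r \<ge> 0 \<Longrightarrow> has_wderiv {-1..0} (\<phi> r) (snd (X r))"
    by (simp add: X_def has_wderiv_wderiv)
  have wd0: "has_wderiv {-1..0} \<phi>0 (?D \<phi>0)" by (rule has_wderiv_wderiv[OF W0])
  have XZ: "\<And>r. r \<ge> 0 \<Longrightarrow> X r \<in> Z_space" using wd has_wderiv_L2 by (auto simp: Z_space_iff)
  have X_pair: "(x r, snd (X r)) = X r" for r by (simp add: X_def)
  have v: "v t = vout (x t) (w t) (u t) (snd (X t))" if "t \<ge> 0" for t
    by (rule boundary_imp_opT(1)[OF wd[OF that] bc[OF that] vt[OF that]])
  have \<phi>: "\<phi> t s = snd (opT S (X t)) s + BT (w t) (u t)" if "t \<ge> 0" "s \<in> {-1..0}" for t s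
    using boundary_imp_opT(2)[OF wd[OF that(1)] bc[OF that(1)] vt[OF that(1)] that(2)] X_pair by simp
  obtain C where C: "C \<ge> 0"
    "\<And>X. X \<in> Z_space \<Longrightarrow> (norm (T_end X))\<^sup>2 \<le> C * (Z_norm X)\<^sup>2"
    "\<And>X. X \<in> Z_space \<Longrightarrow> (L2_norm {-1..0} (snd (opT S X)))\<^sup>2 \<le> C * (Z_norm X)\<^sup>2"
    by (fact opT_bound)
  have "Z_eq (X 0) (x0, ?D \<phi>0)"
    unfolding Z_eq_def
    using x0 has_wderiv_unique[OF has_wderiv_cong[OF wd[of 0] \<phi>0] wd0] by (simp add: X_def)
  moreover have "(x0, ?D \<phi>0) \<in> Z_space" using wd0 by (simp add: Z_space_iff has_wderiv_L2)
  moreover have "z t = opC1 S (X t) + bD11 S *v w t + bD12 S *v u t" if "t \<ge> 0" for t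
    using zt[OF that] v[OF that] opC1_eq[of "x t" "snd (X t)"] XZ[OF that] X_pair[of t] by simp
  moreover have "y t = opC2 S (X t) + bD21 S *v w t + bD22 S *v u t" if "t \<ge> 0" for t
    using yt[OF that] v[OF that] opC2_eq[of "x t" "snd (X t)"] XZ[OF that] X_pair[of t] by simp
  moreover have "\<exists>d b. frechet_deriv Z_space Z_norm X d t \<and>
      frechet_deriv Z_space Z_norm (\<lambda>r. opBT1 S (w r) + opBT2 S (u r)) b t \<and>
      Z_eq (opT S d + b) (opA S (X t) + opB1 S (w t) + opB2 S (u t))" if t: "t \<ge> 0" for t
  proof -
    let ?F = "at t within {0..}"
    obtain d where d: "frechet_deriv (W12 {-1..0}) (W12_norm {-1..0}) \<phi> d t"
      and dAE: "AE s in leb_I. \<forall>i c. blk S c = i \<longrightarrow> d s $ c = (1 / tau S i) * ?D (\<phi> t) s $ c"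
      using d\<phi>[OF t] by blast
    \<comment> \<open>The second component is the weak derivative of the time derivative
      \<open>d\<close>, because weak differentiation is bounded from \<open>W12\<close> to
      \<open>L2\<close>.\<close>
    define D where "D = (A0 S *v x t + B1 S *v w t + B2 S *v u t + Bv S *v v t, ?D d)"
    \<comment> \<open>Forced by differentiating \<open>\<phi> = T X + BT\<close> in time; then
      \<open>opT S D + b\<close> has function component \<open>d\<close>.\<close>
    define b where "b = (0::real^'n, \<lambda>s. d s - snd (opT S D) s)"
    define h where "h = (\<lambda>r. (\<phi> r - \<phi> t) /\<^sub>R (r - t) - d)"
    define Q where "Q = (\<lambda>r. (X r - X t) /\<^sub>R (r - t) - D)"
    have wdd: "has_wderiv {-1..0} d (snd D)"
      using d by (simp add: frechet_deriv_def D_def has_wderiv_wderiv)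
    have DZ: "D \<in> Z_space" using wdd has_wderiv_L2 by (auto simp: Z_space_iff)
    have wdh: "has_wderiv {-1..0} (h r) (snd (Q r))" if "r \<ge> 0" for r
      using has_wderiv_quotient[OF wd[OF that] wd[OF t] wdd] by (simp add: h_def Q_def)
    have QZ: "Q r \<in> Z_space" if "r \<ge> 0" for r
      unfolding Q_def by (intro Z_space_quotient XZ that t DZ)
    have lim_h: "((\<lambda>r. W12_norm {-1..0} (h r)) \<longlongrightarrow> 0) ?F"
      using d by (simp add: frechet_deriv_def h_def)
    have lim_x: "((\<lambda>r. norm (fst (Q r))) \<longlongrightarrow> 0) ?F"
      using dx[OF t] unfolding has_vector_derivative_iff_quotient by (simp add: Q_def X_def D_def)
    have lim_Q: "((\<lambda>r. Z_norm (Q r)) \<longlongrightarrow> 0) ?F"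
    proof (rule tendsto_zero_sq_le)
      \<comment> \<open>The function component of \<open>Q r\<close> is the weak derivative of
        \<open>h r\<close>, so its norm is part of the \<open>W12\<close> norm of
        \<open>h r\<close>.\<close>
      show "\<forall>\<^sub>F r in ?F. (Z_norm (Q r))\<^sup>2 \<le> (norm (fst (Q r)))\<^sup>2 + (W12_norm {-1..0} (h r))\<^sup>2"
        using eventually_at_within_Ici
        by (rule eventually_mono) (simp add: Z_norm_sq W12_norm_sq[OF wdh])
      show "((\<lambda>r. (norm (fst (Q r)))\<^sup>2 + (W12_norm {-1..0} (h r))\<^sup>2) \<longlongrightarrow> 0) ?F"
        using tendsto_add[OF tendsto_zero_sq[OF lim_x] tendsto_zero_sq[OF lim_h]] by simp
    qed
    have bL: "(\<lambda>s. d s - snd (opT S D) s) \<in> L2 {-1..0}"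
      by (intro L2_diff has_wderiv_imp_L2[OF wdd] has_wderiv_imp_L2[OF opT_has_wderiv[OF DZ]])
    let ?G = "\<lambda>r. (0::real^'n, \<lambda>s::real. BT (w r) (u r))"
    have Gsq: "(Z_norm ((?G r - ?G t) /\<^sub>R (r - t) - b))\<^sup>2 \<le>
        2 * (W12_norm {-1..0} (h r))\<^sup>2 + 2 * (C * (Z_norm (Q r))\<^sup>2)" if r: "r \<ge> 0" for r
    proof -
      \<comment> \<open>By linearity of T, the error of the quotient of \<open>BT\<close> is the
        error \<open>h r\<close> for \<open>\<phi>\<close> minus T applied to the error
        \<open>Q r\<close> for \<open>X\<close>.\<close>
      have "(Z_norm ((?G r - ?G t) /\<^sub>R (r - t) - b))\<^sup>2 =
          (L2_norm {-1..0} (\<lambda>s. h r s - snd (opT S (Q r)) s))\<^sup>2"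
      proof -
        have "L2_norm {-1..0} (snd ((?G r - ?G t) /\<^sub>R (r - t) - b)) =
            L2_norm {-1..0} (\<lambda>s. h r s - snd (opT S (Q r)) s)"
        proof (rule L2_norm_cong)
        fix s :: real assume s: "s \<in> {-1..0}"
        show "snd ((?G r - ?G t) /\<^sub>R (r - t) - b) s = h r s - snd (opT S (Q r)) s"
          unfolding Q_def opT_quotient[OF XZ[OF r] XZ[OF t] DZ s]
          by (simp add: h_def b_def scaleR_fun_def \<phi>[OF r s] \<phi>[OF t s] algebra_simps)
        qed
        moreover have "fst ((?G r - ?G t) /\<^sub>R (r - t) - b) = 0" by (simp add: b_def)
        ultimately show ?thesis by (simp only: Z_norm_sq) simp
      qed
      also have "\<dots> \<le> 2 * (L2_norm {-1..0} (h r))\<^sup>2 + 2 * (L2_norm {-1..0} (snd (opT S (Q r))))\<^sup>2"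
        by (intro L2_norm_sq_diff_le has_wderiv_imp_L2[OF wdh[OF r]] has_wderiv_imp_L2[OF opT_has_wderiv[OF QZ[OF r]]])
      also have "\<dots> \<le> 2 * (W12_norm {-1..0} (h r))\<^sup>2 + 2 * (C * (Z_norm (Q r))\<^sup>2)"
        using C(3)[OF QZ[OF r]] W12_norm_sq[OF wdh[OF r]] by (intro add_mono mult_left_mono) auto
      finally show ?thesis .
    qed
    have lim_G: "((\<lambda>r. Z_norm ((?G r - ?G t) /\<^sub>R (r - t) - b)) \<longlongrightarrow> 0) ?F"
    proof (rule tendsto_zero_sq_le)
      show "\<forall>\<^sub>F r in ?F. (Z_norm ((?G r - ?G t) /\<^sub>R (r - t) - b))\<^sup>2 \<le>
          2 * (W12_norm {-1..0} (h r))\<^sup>2 + 2 * (C * (Z_norm (Q r))\<^sup>2)"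
        using eventually_at_within_Ici by (rule eventually_mono) (rule Gsq)
      have "((\<lambda>r. 2 * (W12_norm {-1..0} (h r))\<^sup>2 + 2 * (C * (Z_norm (Q r))\<^sup>2)) \<longlongrightarrow> 2 * 0 + 2 * (C * 0)) ?F"
        by (intro tendsto_add tendsto_mult tendsto_const tendsto_zero_sq[OF lim_h] tendsto_zero_sq[OF lim_Q])
      then show "((\<lambda>r. 2 * (W12_norm {-1..0} (h r))\<^sup>2 + 2 * (C * (Z_norm (Q r))\<^sup>2)) \<longlongrightarrow> 0) ?F" by simp
    qed
    have "frechet_deriv Z_space Z_norm X D t"
      using XZ DZ lim_Q by (simp add: frechet_deriv_def Q_def)
    moreover have "frechet_deriv Z_space Z_norm (\<lambda>r. opBT1 S (w r) + opBT2 S (u r)) b t"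
      unfolding frechet_deriv_def opBT_eq
      using lim_G bL by (simp add: Z_space_iff b_def L2_const)
    moreover have "Z_eq (opT S D + b) (opA S (X t) + opB1 S (w t) + opB2 S (u t))"
      unfolding Z_eq_def
    proof
      show "fst (opT S D + b) = fst (opA S (X t) + opB1 S (w t) + opB2 S (u t))"
        using fst_opA[of "x t" "snd (X t)"] XZ[OF t] X_pair[of t] v[OF t]
        by (simp add: b_def D_def opT_def)
      show "AE s in leb_I. snd (opT S D + b) s = snd (opA S (X t) + opB1 S (w t) + opB2 S (u t)) s"
        using dAE unfolding snd_opA
        by (rule eventually_mono) (simp add: b_def vec_eq_iff Itau_mult_nth X_def)
    qed
    ultimately show ?thesis by blast
  qed
  ultimately show ?thesis
    unfolding satisfies_PIE_def X_def[symmetric] by blast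
qed

section \<open>From the PIE to the ODE-PDE\<close>

lemma PIE_imp_ODE_PDE:
  assumes X0: "X0 \<in> Z_space"
    and pie: "satisfies_PIE S u w X0 X y z"
    and BT0: "BT (w 0) (u 0) = 0"
    and \<phi>_def: "\<phi> = (\<lambda>t s. snd (opT S (X t)) s + BT (w t) (u t))"
  shows "satisfies_ODE_PDE S u w (fst X0) (snd (opT S X0)) (\<lambda>t. fst (X t)) \<phi> (\<lambda>t. delay_out S (\<phi> t)) y z"
proof -
  have X00: "Z_eq (X 0) X0"
    and dX: "\<And>t. t \<ge> 0 \<Longrightarrow> \<exists>d b. frechet_deriv Z_space Z_norm X d t \<and>
        frechet_deriv Z_space Z_norm (\<lambda>r. opBT1 S (w r) + opBT2 S (u r)) b t \<and>
        Z_eq (opT S d + b) (opA S (X t) + opB1 S (w t) + opB2 S (u t))"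
    and zt: "\<And>t. t \<ge> 0 \<Longrightarrow> z t = opC1 S (X t) + bD11 S *v w t + bD12 S *v u t"
    and yt: "\<And>t. t \<ge> 0 \<Longrightarrow> y t = opC2 S (X t) + bD21 S *v w t + bD22 S *v u t"
    using pie unfolding satisfies_PIE_def by auto
  have XZ: "\<And>r. r \<ge> 0 \<Longrightarrow> X r \<in> Z_space" using dX[of 0] unfolding frechet_deriv_def by blast
  have \<phi>_eq: "\<phi> t = (\<lambda>s. snd (opT S (X t)) s + BT (w t) (u t))" for t by (simp add: \<phi>_def)
  note bd = opT_imp_boundary[OF XZ \<phi>_eq]
  obtain C where C: "C \<ge> 0"
    "\<And>X. X \<in> Z_space \<Longrightarrow> (norm (T_end X))\<^sup>2 \<le> C * (Z_norm X)\<^sup>2"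
    "\<And>X. X \<in> Z_space \<Longrightarrow> (L2_norm {-1..0} (snd (opT S X)))\<^sup>2 \<le> C * (Z_norm X)\<^sup>2"
    by (fact opT_bound)
  \<comment> \<open>Zero inputs give the initial function the form required by
    \<open>opT_imp_boundary\<close>.\<close>
  have 0: "snd (opT S X0) = (\<lambda>s. snd (opT S X0) s + BT 0 0)" by (simp add: BT_def)
  note bd0 = opT_imp_boundary[OF X0 0]
  have "snd (opT S X0) \<in> W12 {-1..0}" using bd0(1) by (rule has_wderiv_imp_W12)
  moreover have "sewing S (fst X0) (snd (opT S X0))"
    using bd0(3) by (simp add: sewing_def)
  moreover have "fst (X 0) = fst X0" using X00 by (simp add: Z_eq_def)
  \<comment> \<open>\<open>X 0\<close> and \<open>X0\<close> agree only almost everywhere in the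
    function component; T makes this a pointwise statement, and \<open>BT\<close> vanishes at time
    0.\<close>
  moreover have "\<forall>s\<in>{-1..0}. \<phi> 0 s = snd (opT S X0) s"
    using opT_cong_AE[OF XZ[of 0] X0 X00] by (simp add: \<phi>_def BT0)
  moreover have "z t = C1 S *v fst (X t) + D11 S *v w t + D12 S *v u t + D1v S *v delay_out S (\<phi> t)" if "t \<ge> 0" for t
    using zt[OF that] opC1_eq[of "fst (X t)" "snd (X t)"] XZ[OF that] bd(2)[OF that] by simp
  moreover have "y t = C2 S *v fst (X t) + D21 S *v w t + D22 S *v u t + D2v S *v delay_out S (\<phi> t)" if "t \<ge> 0" for t
    using yt[OF that] opC2_eq[of "fst (X t)" "snd (X t)"] XZ[OF that] bd(2)[OF that] by simp
  moreover have "\<phi> t 0 = Cr S *v fst (X t) + Br1 S *v w t + Br2 S *v u t + Drv S *v delay_out S (\<phi> t)" if "t \<ge> 0" for t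
    by (rule bd(3)[OF that])
  moreover have "((\<lambda>t. fst (X t)) has_vector_derivative
        (A0 S *v fst (X t) + B1 S *v w t + B2 S *v u t + Bv S *v delay_out S (\<phi> t))) (at t within {0..}) \<and>
      (\<exists>d. frechet_deriv (W12 {-1..0}) (W12_norm {-1..0}) \<phi> d t \<and>
        (AE s in leb_I. \<forall>i c. blk S c = i \<longrightarrow> d s $ c = (1 / tau S i) * wderiv {-1..0} (\<phi> t) s $ c))"
    if t: "t \<ge> 0" for t
  proof -
    let ?F = "at t within {0..}" and ?G = "\<lambda>r. (0::real^'n, \<lambda>s::real. BT (w r) (u r))"
    have F: "?F \<noteq> bot" by (rule at_within_Ici_neq_bot[OF t])
    obtain D b where D: "frechet_deriv Z_space Z_norm X D t"
      and b: "frechet_deriv Z_space Z_norm ?G b t"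
      and eq: "Z_eq (opT S D + b) (opA S (X t) + opB1 S (w t) + opB2 S (u t))"
      using dX[OF t] unfolding opBT_eq by blast
    define Q where "Q = (\<lambda>r. (X r - X t) /\<^sub>R (r - t) - D)"
    define c where "c = (\<lambda>r. (BT (w r) (u r) - BT (w t) (u t)) /\<^sub>R (r - t))"
    have DZ: "D \<in> Z_space" and bL: "snd b \<in> L2 {-1..0}"
      using D b by (auto simp: frechet_deriv_def Z_space_iff)
    have QZ: "Q r \<in> Z_space" if "r \<ge> 0" for r
      unfolding Q_def by (intro Z_space_quotient XZ that t DZ)
    have lim_Q: "((\<lambda>r. Z_norm (Q r)) \<longlongrightarrow> 0) ?F"
      using D by (simp add: frechet_deriv_def Q_def)
    have lim_b: "((\<lambda>r. (Z_norm ((?G r - ?G t) /\<^sub>R (r - t) - b))\<^sup>2) \<longlongrightarrow> 0) ?F"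
      using b by (intro tendsto_zero_sq) (simp add: frechet_deriv_def)
    \<comment> \<open>The quotient of \<open>?G\<close> has first component zero, so the error
      contains \<open>norm (fst b)\<close> independently of \<open>r\<close>; its convergence to
      zero forces \<open>fst b = 0\<close>.\<close>
    have Zb: "(Z_norm ((?G r - ?G t) /\<^sub>R (r - t) - b))\<^sup>2 =
        (norm (fst b))\<^sup>2 + (L2_norm {-1..0} (\<lambda>s. c r - snd b s))\<^sup>2" for r
      unfolding Z_norm_sq by (simp add: c_def scaleR_fun_def fun_diff_def)
    have "((\<lambda>r. norm (fst b)) \<longlongrightarrow> 0) ?F"
      by (rule tendsto_zero_sq_le[OF _ lim_b]) (unfold Zb, simp)
    then have fst_b: "fst b = 0" using F by (simp add: tendsto_const_iff)
    have "((\<lambda>r. L2_norm {-1..0} (\<lambda>s. c r - snd b s)) \<longlongrightarrow> 0) ?F"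
      by (rule tendsto_zero_sq_le[OF _ lim_b]) (unfold Zb, simp)
    from tendsto_L2_const_limit[OF F bL this]
    obtain \<beta> where \<beta>: "AE s in leb_I. snd b s = \<beta>" and lim_c: "(c \<longlongrightarrow> \<beta>) ?F" by blast
    \<comment> \<open>The constant \<open>\<beta>\<close> replaces \<open>snd b\<close>, which
      equals it only almost everywhere, so that \<open>d\<close> is absolutely continuous and has
      definite point values.\<close>
    define d where "d = (\<lambda>s. snd (opT S D) s + \<beta>)"
    define h where "h = (\<lambda>r. (\<phi> r - \<phi> t) /\<^sub>R (r - t) - d)"
    have wdd: "has_wderiv {-1..0} d (snd D)"
      unfolding d_def by (intro has_wderiv_add_const opT_has_wderiv DZ)
    have wdh: "has_wderiv {-1..0} (h r) (snd (Q r))" if "r \<ge> 0" for r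
      using has_wderiv_quotient[OF bd(1)[OF that] bd(1)[OF t] wdd] by (simp add: h_def Q_def)
    have h0: "h r 0 = T_end (Q r) + (c r - \<beta>)" if r: "r \<ge> 0" for r
      unfolding Q_def T_end_quotient[OF XZ[OF r] XZ[OF t] DZ] h_def c_def d_def \<phi>_def
      by (simp add: scaleR_fun_def snd_opT_0[OF XZ[OF r]] snd_opT_0[OF XZ[OF t]] snd_opT_0[OF DZ] algebra_simps)
    \<comment> \<open>The squared \<open>W12\<close> norm is at most twice the squared end value
      plus three times the squared norm of the derivative. Splitting the end value by
      \<open>h0\<close> doubles again and gives \<open>4 * C + 3\<close> and
      \<open>4\<close>.\<close>
    have h_sq: "(W12_norm {-1..0} (h r))\<^sup>2 \<le> (4 * C + 3) * (Z_norm (Q r))\<^sup>2 + 4 * (norm (c r - \<beta>))\<^sup>2"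
      if r: "r \<ge> 0" for r
    proof -
      have "(L2_norm {-1..0} (snd (Q r)))\<^sup>2 \<le> (Z_norm (Q r))\<^sup>2" by (simp add: Z_norm_sq)
      moreover have "(norm (h r 0))\<^sup>2 \<le> 2 * (norm (T_end (Q r)))\<^sup>2 + 2 * (norm (c r - \<beta>))\<^sup>2"
        unfolding h0[OF r] by (rule norm_sq_add_le)
      ultimately show ?thesis
        using L2_norm_sq_le_wderiv[OF wdh[OF r]] C(2)[OF QZ[OF r]]
        unfolding W12_norm_sq[OF wdh[OF r]] by (simp add: algebra_simps)
    qed
    have "((\<lambda>r. W12_norm {-1..0} (h r)) \<longlongrightarrow> 0) ?F"
    proof (rule tendsto_zero_sq_le)
      show "\<forall>\<^sub>F r in ?F. (W12_norm {-1..0} (h r))\<^sup>2 \<le> (4 * C + 3) * (Z_norm (Q r))\<^sup>2 + 4 * (norm (c r - \<beta>))\<^sup>2"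
        using eventually_at_within_Ici by (rule eventually_mono) (rule h_sq)
      have "((\<lambda>r. norm (c r - \<beta>)) \<longlongrightarrow> 0) ?F" using lim_c by (simp only: tendsto_norm_zero_iff Lim_null[of c])
      then have "((\<lambda>r. (4 * C + 3) * (Z_norm (Q r))\<^sup>2 + 4 * (norm (c r - \<beta>))\<^sup>2) \<longlongrightarrow> (4 * C + 3) * 0 + 4 * 0) ?F"
        by (intro tendsto_add tendsto_mult tendsto_const tendsto_zero_sq lim_Q)
      then show "((\<lambda>r. (4 * C + 3) * (Z_norm (Q r))\<^sup>2 + 4 * (norm (c r - \<beta>))\<^sup>2) \<longlongrightarrow> 0) ?F" by simp
    qed
    then have "frechet_deriv (W12 {-1..0}) (W12_norm {-1..0}) \<phi> d t"
      using has_wderiv_imp_W12[OF bd(1)] has_wderiv_imp_W12[OF wdd] by (simp add: frechet_deriv_def h_def)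
    moreover have "AE s in leb_I. \<forall>i c. blk S c = i \<longrightarrow> d s $ c = (1 / tau S i) * wderiv {-1..0} (\<phi> t) s $ c"
    proof -
      have "AE s in leb_I. snd (opT S D + b) s = Itau S *v snd (X t) s"
        using eq unfolding Z_eq_def snd_opA by blast
      \<comment> \<open>Almost everywhere \<open>d\<close> is the function component of
        \<open>opT S D + b\<close>, and \<open>snd (X t)\<close> is the weak derivative of
        \<open>\<phi> t\<close>; the PIE thus becomes the transport equation.\<close>
      with \<beta> wderiv_AE_eq[OF bd(1)[OF t]] show ?thesis
      proof eventually_elim
        case (elim s)
        then have "d s = Itau S *v wderiv {-1..0} (\<phi> t) s" by (simp add: d_def)
        then show ?case by (simp add: Itau_mult_nth)
      qed
    qed
    moreover have "((\<lambda>t. fst (X t)) has_vector_derivative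
        (A0 S *v fst (X t) + B1 S *v w t + B2 S *v u t + Bv S *v delay_out S (\<phi> t))) ?F"
    proof -
      have "fst D = fst (opT S D + b)" by (simp add: opT_def fst_b)
      also have "\<dots> = A0 S *v fst (X t) + B1 S *v w t + B2 S *v u t + Bv S *v delay_out S (\<phi> t)"
        using eq fst_opA[of "fst (X t)" "snd (X t)"] XZ[OF t] bd(2)[OF t] by (simp add: Z_eq_def)
      finally have fst_D: "fst D = \<dots>" .
      have "((\<lambda>r. norm (fst (Q r))) \<longlongrightarrow> 0) ?F"
        by (rule tendsto_zero_sq_le[OF _ tendsto_zero_sq[OF lim_Q]]) (simp add: Z_norm_sq)
      then show ?thesis
        unfolding has_vector_derivative_iff_quotient fst_D[symmetric] by (simp add: Q_def)
    qed
    ultimately show ?thesis by blast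
  qed
  ultimately show ?thesis unfolding satisfies_ODE_PDE_def by blast
qed

end

theorem lemma4:
  fixes S :: "('n::finite, 'm::finite, 'p::finite, 'q::finite, 'r::finite, 'v::finite, 'c::finite,
               'k::{finite,linorder}) sys"
    and u :: "real \<Rightarrow> real^'p" and w :: "real \<Rightarrow> real^'m"
  assumes tau_pos: "\<And>i. 0 < tau S i"
    and tau_mono: "strict_mono (tau S)"
    and Cvd_measurable:
      "\<And>i. (\<lambda>\<theta>. cblock S i (Cvd S \<theta>)) \<in> borel_measurable (lebesgue_on {- tau S i..0})"
    and Cvd_bounded: "\<And>i. bounded ((\<lambda>\<theta>. cblock S i (Cvd S \<theta>)) ` {- tau S i..0})"
    and inv: "invertible (mat 1 - (\<Sum>i\<in>UNIV. Chat S i ** Drv S))"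
    and u_L2: "u \<in> L2 {0..}"
    and w_L2: "w \<in> L2 {0..}"
    and w_W12: "Br1 S \<noteq> 0 \<Longrightarrow> w \<in> W12 {0..} \<and> w 0 = 0"
    and u_W12: "Br2 S \<noteq> 0 \<Longrightarrow> u \<in> W12 {0..} \<and> u 0 = 0"
  shows
    "(\<forall>x0 \<phi>0 x \<phi> v y z.
        \<phi>0 \<in> W12 {-1..0} \<and> sewing S x0 \<phi>0 \<and> satisfies_ODE_PDE S u w x0 \<phi>0 x \<phi> v y z \<longrightarrow>
        satisfies_PIE S u w (x0, wderiv {-1..0} \<phi>0) (\<lambda>t. (x t, wderiv {-1..0} (\<phi> t))) y z)
     \<and>
     (\<forall>X0 X y z.
        X0 \<in> Z_space \<and> satisfies_PIE S u w X0 X y z \<longrightarrow>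
        (let Y = (\<lambda>t. opT S (X t) + opBT1 S (w t) + opBT2 S (u t));
             x = (\<lambda>t. fst (Y t)); \<phi> = (\<lambda>t. snd (Y t));
             x0 = fst (opT S X0); \<phi>0 = snd (opT S X0);
             v = (\<lambda>t. delay_out S (\<phi> t))
         in satisfies_ODE_PDE S u w x0 \<phi>0 x \<phi> v y z))"
proof -
  interpret delay_system S by standard (fact tau_pos Cvd_measurable Cvd_bounded inv)+
  \<comment> \<open>If \<open>Br1 S = 0\<close>, then \<open>Dvw S\<close> and with it
    \<open>bT1 S\<close> vanish; otherwise \<open>w 0 = 0\<close>. The same alternative applies to
    \<open>u\<close>.\<close>
  have "bT1 S *v w 0 = 0" using w_W12 by (cases "Br1 S = 0") (auto simp: bT1_def Dvw_def)
  moreover have "bT2 S *v u 0 = 0" using u_W12 by (cases "Br2 S = 0") (auto simp: bT2_def Dvu_def)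
  ultimately have BT0: "BT (w 0) (u 0) = 0" by (simp add: BT_def)
  \<comment> \<open>Rewrites the reconstructed state into the explicit form for which the converse
    direction was proved.\<close>
  have Y: "opT S (X t) + opBT1 S (w t) + opBT2 S (u t) =
      (fst (X t), \<lambda>s. snd (opT S (X t)) s + BT (w t) (u t))" for X t
    by (simp add: add.assoc opBT_eq) (simp add: opT_def prod_eq_iff fun_eq_iff)
  have fst_opT: "fst (opT S X0) = fst X0" for X0 by (simp add: opT_def)
  show ?thesis
    unfolding Let_def Y fst_conv snd_conv fst_opT
  proof (intro conjI allI impI; elim conjE)
    fix X0 X y z assume "X0 \<in> Z_space" "satisfies_PIE S u w X0 X y z"
    then show "satisfies_ODE_PDE S u w (fst X0) (snd (opT S X0)) (\<lambda>t. fst (X t))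
        (\<lambda>t s. snd (opT S (X t)) s + BT (w t) (u t))
        (\<lambda>t. delay_out S (\<lambda>s. snd (opT S (X t)) s + BT (w t) (u t))) y z"
      by (rule PIE_imp_ODE_PDE) (use BT0 in simp_all)
  qed (rule ODE_PDE_imp_PIE)
qed

end
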